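(* An optimal disclosure rule exists, and every optimal rule $d^*$ has a threshold structure: there is a threshold value $\bar x\in\mathcal X$ and a threshold profitability $\bar y:\mathcal X\to\mathcal Y$ such that $d^*$ almost everywhere satisfies $d^*(x,y)\in\{0,1\}$ and $$d^*(x,y)=1\iff (x-\bar x)(y-\bar y(x))\ge 0 .$$ The threshold value satisfies $\bar x=x^{ND}$, and, for $x\ne x^{ND}$, $\bar y(x)$ satisfies $$\bar y(x)=y^{ND}\left[\frac{p'(x^{ND})\,(x^{ND}-x)}{p(x^{ND})-p(x)}\right],$$ where $x^{ND}=x^{ND}(d^* )$ and $y^{ND}=y^{ND}(d^* )$.
   Context: An object has a value to a buyer, lying in $\mathcal X=[x_{min},x_{max}]$, and a profitability $y$ to a seller, lying in $\mathcal Y=[y_{min},y_{max}]$ with $y_{min}\ge 0$. Value and profitability are drawn from a commonly known joint distribution; the joint distribution and its marginals have no mass points. $F_Y$ is the marginal cdf of profitability. The seller observes $y$ and the realization of a signal about the value. A signal realization is identified with the posterior mean $x\in\mathcal X$ of the value that it induces, and it is assumed that, given the realization, this posterior mean does not depend on $y$. Conditional on $y$, the realization $x$ has cdf $F_{X|y}$ (which may vary with $y$). The demand function $p:\mathcal X\to[0,1]$ is strictly increasing and differentiable; $p(\hat x)$ is the probability that the buyer purchases when the buyer's posterior mean of the value is $\hat x$. The seller gets $y$ if the object is sold and $0$ otherwise. A disclosure rule, to which the seller commits ex ante, is a measurable map $d$ assigning to each $(x,y)\in\mathcal X\times\mathcal Y$ a disclosure probability $d(x,y)\in[0,1]$. If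 $x$ is disclosed the buyer's posterior mean is $x$; otherwise (the buyer does not observe $y$) it is $$x^{ND}(d)=\frac{\int_{\mathcal Y}\int_{\mathcal X}x(1-d(x,y))\,dF_{X|y}(x)\,dF_Y(y)}{\int_{\mathcal Y}\int_{\mathcal X}(1-d(x,y))\,dF_{X|y}(x)\,dF_Y(y)}$$ (if the denominator is zero, $x^{ND}$ is fixed at some value in $\mathcal X$). $y^{ND}(d)$ is defined analogously as the average profitability conditional on non-disclosure. Put $$P(y,d)=\int_{\mathcal X}\left[d(x,y)p(x)+(1-d(x,y))p(x^{ND}(d))\right]dF_{X|y}(x),\qquad \Pi(d)=\int_{\mathcal Y}yP(y,d)\,dF_Y(y).$$ A disclosure rule is optimal if it maximizes $\Pi$ over all disclosure rules.
   Formalization: If almost everything is disclosed, the claim holds for some choice of x^ND, y^ND; the rule is asserted off ties x = x̄ or y = ȳ(x), and a.e. if the signal and the law of y given x have no mass points; ȳ(x) is the formula projected onto [y_min, y_max]. *)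

theory Defs
  imports "HOL-Probability.Probability"
begin

text \<open>
  \<open>val\<close>, \<open>sig\<close> and \<open>prof\<close> are the buyer's value, the signal realization (identified with the
  posterior mean it induces) and the seller's profitability. \<open>FY\<close> is the law of \<open>prof\<close> and
  \<open>K y\<close> the conditional law of \<open>sig\<close> given \<open>prof = y\<close>, that is, the measure with cdf
  $F_{X|y}$. A mass point of the joint law of \<open>(val, prof)\<close> would give one of each marginal, so
  only the marginals are mentioned. \<open>sig\<close> itself may have mass points (a coarse signal).
  The derivative of \<open>p\<close> is one-sided at the endpoints of \<open>X\<close>; outside \<open>X\<close> the function \<open>p\<close> is
  unconstrained, possibly not even measurable, whence the set integrals below.
\<close>

locale disclosure_model = prob_space M
  for M :: "'a measure" +
  fixes val sig prof :: "'a \<Rightarrow> real"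
    and xmin xmax ymin ymax :: real
    and X Y :: "real set"
    and FY :: "real measure"
    and K :: "real \<Rightarrow> real measure"
    and p p' :: "real \<Rightarrow> real"
  assumes X_eq: "X = {xmin..xmax}"
    and Y_eq: "Y = {ymin..ymax}"
    and ymin_nonneg: "0 \<le> ymin"
    and val_measurable: "val \<in> borel_measurable M"
    and sig_measurable: "sig \<in> borel_measurable M"
    and prof_measurable: "prof \<in> borel_measurable M"
    and val_range: "\<And>w. w \<in> space M \<Longrightarrow> val w \<in> X"
    and sig_range: "\<And>w. w \<in> space M \<Longrightarrow> sig w \<in> X"
    and prof_range: "\<And>w. w \<in> space M \<Longrightarrow> prof w \<in> Y"
    and val_no_mass_points: "\<And>v. prob {w \<in> space M. val w = v} = 0"
    and prof_no_mass_points: "\<And>y. prob {w \<in> space M. prof w = y} = 0"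
    and posterior_mean:
      "AE w in M. real_cond_exp M
         (vimage_algebra (space M) (\<lambda>w. (sig w, prof w)) (borel \<Otimes>\<^sub>M borel)) val w = sig w"
    and FY_eq: "FY = distr M borel prof"
    and K_kernel: "K \<in> borel \<rightarrow>\<^sub>M prob_algebra borel"
    and K_conditional:
      "distr M (borel \<Otimes>\<^sub>M borel) (\<lambda>w. (sig w, prof w)) =
         FY \<bind> (\<lambda>y. distr (K y) (borel \<Otimes>\<^sub>M borel) (\<lambda>x. (x, y)))"
    and p_range: "p \<in> X \<rightarrow> {0..1}"
    and p_strict_mono: "strict_mono_on X p"
    and p_deriv: "\<And>x. x \<in> X \<Longrightarrow> (p has_real_derivative p' x) (at x within X)"

definition disclosure_rule :: "real set \<Rightarrow> real set \<Rightarrow> (real \<Rightarrow> real \<Rightarrow> real) \<Rightarrow> bool" where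
  "disclosure_rule X Y d \<longleftrightarrow>
     (\<lambda>(x, y). d x y) \<in> borel_measurable (restrict_space borel (X \<times> Y)) \<and>
     (\<forall>x\<in>X. \<forall>y\<in>Y. d x y \<in> {0..1})"

definition nd_mass ::
  "real set \<Rightarrow> real set \<Rightarrow> real measure \<Rightarrow> (real \<Rightarrow> real measure) \<Rightarrow> (real \<Rightarrow> real \<Rightarrow> real) \<Rightarrow> real" where
  "nd_mass X Y FY K d = (LINT y:Y|FY. (LINT x:X|K y. 1 - d x y))"

text \<open>The arguments \<open>x0\<close> and \<open>y0\<close> are the values used when (almost) everything is disclosed.\<close>

definition x_nd ::
  "real set \<Rightarrow> real set \<Rightarrow> real measure \<Rightarrow> (real \<Rightarrow> real measure) \<Rightarrow> real \<Rightarrow> (real \<Rightarrow> real \<Rightarrow> real) \<Rightarrow> real" where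
  "x_nd X Y FY K x0 d =
     (if nd_mass X Y FY K d = 0 then x0
      else (LINT y:Y|FY. (LINT x:X|K y. x * (1 - d x y))) / nd_mass X Y FY K d)"

definition y_nd ::
  "real set \<Rightarrow> real set \<Rightarrow> real measure \<Rightarrow> (real \<Rightarrow> real measure) \<Rightarrow> real \<Rightarrow> (real \<Rightarrow> real \<Rightarrow> real) \<Rightarrow> real" where
  "y_nd X Y FY K y0 d =
     (if nd_mass X Y FY K d = 0 then y0
      else (LINT y:Y|FY. (LINT x:X|K y. y * (1 - d x y))) / nd_mass X Y FY K d)"

definition sale_prob ::
  "real set \<Rightarrow> real set \<Rightarrow> real measure \<Rightarrow> (real \<Rightarrow> real measure) \<Rightarrow> (real \<Rightarrow> real) \<Rightarrow> real \<Rightarrow>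
   real \<Rightarrow> (real \<Rightarrow> real \<Rightarrow> real) \<Rightarrow> real" where
  "sale_prob X Y FY K p x0 y d =
     (LINT x:X|K y. d x y * p x + (1 - d x y) * p (x_nd X Y FY K x0 d))"

definition profit ::
  "real set \<Rightarrow> real set \<Rightarrow> real measure \<Rightarrow> (real \<Rightarrow> real measure) \<Rightarrow> (real \<Rightarrow> real) \<Rightarrow> real \<Rightarrow>
   (real \<Rightarrow> real \<Rightarrow> real) \<Rightarrow> real" where
  "profit X Y FY K p x0 d = (LINT y:Y|FY. y * sale_prob X Y FY K p x0 y d)"

definition optimal_rule ::
  "real set \<Rightarrow> real set \<Rightarrow> real measure \<Rightarrow> (real \<Rightarrow> real measure) \<Rightarrow> (real \<Rightarrow> real) \<Rightarrow> real \<Rightarrow>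
   (real \<Rightarrow> real \<Rightarrow> real) \<Rightarrow> bool" where
  "optimal_rule X Y FY K p x0 d \<longleftrightarrow>
     disclosure_rule X Y d \<and>
     (\<forall>d'. disclosure_rule X Y d' \<longrightarrow> profit X Y FY K p x0 d' \<le> profit X Y FY K p x0 d)"

text \<open>
  No mass points in the law of the signal, nor in the conditional law of profitability given the
  signal. The latter is expressed by saying that graphs of functions of the signal are null.
  Both hold when \<open>(sig, prof)\<close> has a density, but neither follows from the absence of
  mass points in the law of \<open>(val, prof)\<close>.
\<close>

definition tie_free :: "'a measure \<Rightarrow> ('a \<Rightarrow> real) \<Rightarrow> ('a \<Rightarrow> real) \<Rightarrow> bool" where
  "tie_free M sig prof \<longleftrightarrow>
     (\<forall>c. AE w in M. sig w \<noteq> c) \<and>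
     (\<forall>g \<in> borel_measurable borel. AE w in M. prof w \<noteq> g (sig w))"

end

theory Submission
  imports Defs "HOL-Real_Asymp.Real_Asymp"
begin

text \<open>
  In terms of the non-disclosure weight \<open>e = 1 - d\<close>, the profit depends on the rule only through
  the four moments \<open>n\<close>, \<open>a\<close>, \<open>b\<close>, \<open>c\<close>, the integrals of \<open>e\<close> times \<open>1\<close>, \<open>x\<close>, \<open>y\<close>, \<open>y p(x)\<close>: up to a
  constant it is \<open>b p(a/n) - c\<close>. The moments range over a compact convex set, on which this function
  is continuous, so a maximum exists. Moving from an optimal \<open>e\<close> towards another weight \<open>h\<close> and
  differentiating gives, with \<open>m = a/n\<close> and \<open>r = b/n\<close>, that \<open>h = e\<close> maximizes the integral of
  \<open>h(x, y) (y (p(m) - p(x)) + r p'(m) (x - m))\<close>. Hence \<open>e\<close> is \<open>1\<close> where the second factor is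
  positive and \<open>0\<close> where it is negative, and its sign is that of
  \<open>(m - x) (y - r p'(m) (m - x) / (p(m) - p(x)))\<close>.

  If full disclosure is optimal then \<open>n = 0\<close>, and the same condition holds with \<open>(m, r)\<close> any point
  of the support of the joint law of \<open>x\<close> and \<open>y\<close>.
\<close>

section \<open>Integrals against weights\<close>

text \<open>The bounds hold at every point of the space, not just almost everywhere, so that weights
  on the joint law correspond exactly to disclosure rules.\<close>

definition weights :: "'a measure \<Rightarrow> ('a \<Rightarrow> real) set" where
  "weights M = {e \<in> borel_measurable M. \<forall>z\<in>space M. 0 \<le> e z \<and> e z \<le> 1}"

lemma weightsD:
  assumes "e \<in> weights M"
  shows "e \<in> borel_measurable M" "z \<in> space M \<Longrightarrow> 0 \<le> e z" "z \<in> space M \<Longrightarrow> e z \<le> 1"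
  using assms by (auto simp: weights_def)

lemma weights_convex:
  assumes "e \<in> weights M" "e' \<in> weights M" "0 \<le> t" "t \<le> 1"
  shows "(\<lambda>z. (1 - t) * e z + t * e' z) \<in> weights M"
  using assms by (auto simp: weights_def intro!: convex_bound_le)

lemma weighted_integrable:
  fixes f :: "'a \<Rightarrow> 'b::{banach,second_countable_topology}"
  assumes "e \<in> weights M" "integrable M f"
  shows "integrable M (\<lambda>z. e z *\<^sub>R f z)"
proof (rule Bochner_Integration.integrable_bound[OF assms(2)])
  show "(\<lambda>z. e z *\<^sub>R f z) \<in> borel_measurable M"
    using assms by (auto simp: weights_def)
  show "AE z in M. norm (e z *\<^sub>R f z) \<le> norm (f z)"
    using weightsD[OF assms(1)] by (intro AE_I2) (auto intro: mult_left_le_one_le)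
qed

lemma weighted_integral_linear:
  fixes f :: "'a \<Rightarrow> 'b::{banach,second_countable_topology}"
  assumes "e \<in> weights M" "h \<in> weights M" "integrable M f"
  shows "(\<integral>z. (s * e z + t * h z) *\<^sub>R f z \<partial>M)
    = s *\<^sub>R (\<integral>z. e z *\<^sub>R f z \<partial>M) + t *\<^sub>R (\<integral>z. h z *\<^sub>R f z \<partial>M)"
proof -
  note I = assms(1,2)[THEN weighted_integrable, OF assms(3)]
  have "(\<integral>z. (s * e z + t * h z) *\<^sub>R f z \<partial>M) = (\<integral>z. s *\<^sub>R (e z *\<^sub>R f z) + t *\<^sub>R (h z *\<^sub>R f z) \<partial>M)"
    by (simp only: scaleR_add_left scaleR_scaleR)
  also have "\<dots> = (\<integral>z. s *\<^sub>R (e z *\<^sub>R f z) \<partial>M) + (\<integral>z. t *\<^sub>R (h z *\<^sub>R f z) \<partial>M)"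
    using I by (intro Bochner_Integration.integral_add integrable_scaleR_right)
  finally show ?thesis by (simp only: integral_scaleR_right)
qed

text \<open>
  Closedness: among the weights whose integral is within \<open>1 / n\<close> of a limit point \<open>z\<close>, take one
  of almost minimal $L^2$ norm. By the parallelogram identity these form a Cauchy sequence, so
  weak-* compactness of the unit ball of $L^\<infinity>$ is not needed.
\<close>

lemma (in finite_measure) compact_weighted_integrals:
  fixes f :: "'a \<Rightarrow> 'b::euclidean_space"
  assumes f: "integrable M f"
  shows "compact ((\<lambda>e. \<integral>z. e z *\<^sub>R f z \<partial>M) ` weights M)"
proof -
  define I where "I e = (\<integral>z. e z *\<^sub>R f z \<partial>M)" for e
  define Q where "Q e = (\<integral>z. (e z)\<^sup>2 \<partial>M)" for e :: "'a \<Rightarrow> real"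
  note fm = borel_measurable_integrable[OF f]
  have int_sq: "integrable M (\<lambda>z. e z * e' z)" if "e \<in> weights M" "e' \<in> weights M" for e e'
    using weightsD[OF that(1)] weightsD[OF that(2)]
    by (intro integrable_const_bound[of _ 1]) (auto intro!: AE_I2 simp: abs_mult mult_le_one)
  have I_mid: "I (\<lambda>z. (1 - 1/2) * e z + 1/2 * e' z) = (1/2) *\<^sub>R (I e + I e')"
    if "e \<in> weights M" "e' \<in> weights M" for e e'
    unfolding I_def weighted_integral_linear[OF that f] by (simp add: scaleR_add_right)
  have "bounded (I ` weights M)"
  proof -
    have "norm (I e) \<le> (\<integral>z. norm (f z) \<partial>M)" if "e \<in> weights M" for e
    proof -
      have "norm (I e) \<le> (\<integral>z. norm (e z *\<^sub>R f z) \<partial>M)"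
        unfolding I_def by (rule integral_norm_bound)
      also have "\<dots> \<le> (\<integral>z. norm (f z) \<partial>M)"
        using weightsD[OF that] weighted_integrable[OF that f] f
        by (intro integral_mono integrable_norm) (auto intro: mult_left_le_one_le)
      finally show ?thesis .
    qed
    then show ?thesis unfolding bounded_iff by auto
  qed
  moreover have "closed (I ` weights M)"
  proof -
    have "z \<in> I ` weights M" if z: "z \<in> closure (I ` weights M)" for z
    proof -
      define D where "D n = {e \<in> weights M. dist (I e) z \<le> 1 / (real n + 1)}" for n :: nat
      have D_ne: "D n \<noteq> {}" for n
      proof -
        have "0 < 1 / (real n + 1)" by simp
        then obtain e where "e \<in> weights M" "dist (I e) z < 1 / (real n + 1)"
          using z unfolding closure_approachable by blast
        then show ?thesis unfolding D_def by force
      qed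
      have D_mono: "D n \<subseteq> D m" if "m \<le> n" for m n
      proof -
        have "1 / (real n + 1) \<le> 1 / (real m + 1)" using that by (simp add: frac_le)
        then show ?thesis by (auto simp: D_def intro: order_trans)
      qed
      have D_mid: "(\<lambda>z. (1 - 1/2) * e z + 1/2 * e' z) \<in> D n" if "e \<in> D n" "e' \<in> D n" for e e' n
      proof -
        have w: "e \<in> weights M" "e' \<in> weights M" using that by (auto simp: D_def)
        have "dist (I (\<lambda>z. (1 - 1/2) * e z + 1/2 * e' z)) z
            = norm ((1/2) *\<^sub>R (I e - z) + (1/2) *\<^sub>R (I e' - z))"
        proof -
          have "(1/2) *\<^sub>R z + (1/2) *\<^sub>R z = z" by (simp flip: scaleR_add_left)
          then show ?thesis unfolding I_mid[OF w] dist_norm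
            by (intro arg_cong[of _ _ norm]) (simp add: algebra_simps)
        qed
        also have "\<dots> \<le> (1/2) * norm (I e - z) + (1/2) * norm (I e' - z)"
          by (rule order_trans[OF norm_triangle_ineq]) simp
        also have "\<dots> \<le> 1 / (real n + 1)"
          using that by (auto simp: D_def dist_norm)
        finally show ?thesis using weights_convex[OF w, of "1/2"] by (simp add: D_def)
      qed
      \<comment> \<open>The sets \<open>D n\<close> shrink, so these infima increase; they are
        bounded by the total mass and hence converge.\<close>
      define v where "v n = Inf (Q ` D n)" for n
      have Q_nonneg: "0 \<le> Q e" for e unfolding Q_def by simp
      have bdd: "bdd_below (Q ` D n)" for n by (rule bdd_belowI[of _ 0]) (auto simp: Q_nonneg)
      have v_le: "v n \<le> Q e" if "e \<in> D n" for e n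
        unfolding v_def using bdd that by (auto intro: cINF_lower)
      have v_mono: "v m \<le> v n" if "m \<le> n" for m n
        unfolding v_def using D_mono[OF that] D_ne[of n] bdd[of m]
        by (intro cInf_superset_mono) auto
      have "v n \<le> measure M (space M)" for n
      proof -
        obtain e where e: "e \<in> D n" using D_ne by blast
        then have w: "e \<in> weights M" by (auto simp: D_def)
        have "v n \<le> Q e" by (rule v_le[OF e])
        also have "\<dots> \<le> (\<integral>z. 1 \<partial>M)"
          unfolding Q_def using int_sq[OF w w] weightsD[OF w]
          by (intro integral_mono) (auto simp: power2_eq_square mult_le_one)
        finally show ?thesis by simp
      qed
      then obtain V where V: "v \<longlonglongrightarrow> V" "\<And>n. v n \<le> V"
        using incseq_convergent[of v] v_mono unfolding incseq_def by (metis)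
      have "\<exists>e\<in>D n. Q e < v n + 1 / (real n + 1)" for n
      proof -
        have "Inf (Q ` D n) < v n + 1 / (real n + 1)" unfolding v_def by simp
        then show ?thesis using cInf_lessD[of "Q ` D n"] D_ne by auto
      qed
      then obtain g where g: "\<And>n. g n \<in> D n" "\<And>n. Q (g n) < v n + 1 / (real n + 1)"
        by metis
      have gw: "g n \<in> weights M" for n using g(1) by (auto simp: D_def)
      note [measurable] = weightsD(1)[OF gw]
      \<comment> \<open>The midpoint \<open>a\<close> of \<open>g i\<close> and \<open>g j\<close>
        lies in \<open>D N\<close> again, so \<open>Q a\<close> is at least \<open>v N\<close>,
        while \<open>Q (g i)\<close> and \<open>Q (g j)\<close> are at most
        \<open>V + 1 / (real N + 1)\<close>.\<close>
      have par: "(\<integral>z. (g i z - g j z)\<^sup>2 \<partial>M) \<le> 4 * (V - v N) + 4 / (real N + 1)"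
        if "N \<le> i" "N \<le> j" for i j N
      proof -
        define a where "a = (\<lambda>z. (1 - 1/2) * g i z + 1/2 * g j z)"
        have a: "a \<in> D N" unfolding a_def
          using D_mid g(1) D_mono[OF that(1)] D_mono[OF that(2)] by blast
        then have aw: "a \<in> weights M" by (auto simp: D_def)
        have "(\<integral>z. (g i z - g j z)\<^sup>2 \<partial>M)
            = (\<integral>z. 2 * (g i z * g i z) + 2 * (g j z * g j z) - 4 * (a z * a z) \<partial>M)"
          by (intro Bochner_Integration.integral_cong)
            (auto simp: a_def power2_eq_square field_simps)
        also have "\<dots> = 2 * Q (g i) + 2 * Q (g j) - 4 * Q a"
          unfolding Q_def power2_eq_square using int_sq gw aw by simp
        also have "\<dots> \<le> 2 * (V + 1 / (real N + 1)) + 2 * (V + 1 / (real N + 1)) - 4 * v N"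
        proof -
          have "Q (g k) \<le> V + 1 / (real N + 1)" if "N \<le> k" for k
          proof -
            have "1 / (real k + 1) \<le> 1 / (real N + 1)" using that by (simp add: frac_le)
            from less_le_trans[OF g(2) add_mono[OF V(2)[of k] this]] show ?thesis by simp
          qed
          then show ?thesis using that v_le[OF a]
            by (intro diff_mono add_mono mult_left_mono) auto
        qed
        finally show ?thesis by simp
      qed
      have int_diff: "integrable M (\<lambda>z. (g i z - g j z)\<^sup>2)" for i j
      proof -
        have "integrable M (\<lambda>z. g i z * g i z - 2 * (g i z * g j z) + g j z * g j z)"
          using int_sq gw by simp
        then show ?thesis by (simp add: power2_eq_square algebra_simps)
      qed
      have int_g: "integrable M (g n)" for n
        using weighted_integrable[OF gw, of "\<lambda>_. 1::real" n] by simp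
      have cauchy: "\<exists>N. \<forall>i\<ge>N. \<forall>j\<ge>N. (LINT z|M. norm (g i z - g j z)) < \<epsilon>" if "0 < \<epsilon>" for \<epsilon>
      proof -
        \<comment> \<open>The bound \<open>amgm\<close> below turns closeness in mean square into
          closeness in mean. With this \<delta> its constant term integrates to less than \<epsilon>
          / 2; the \<open>+ 1\<close> covers the null measure.\<close>
        define \<delta> where "\<delta> = \<epsilon> / (measure M (space M) + 1)"
        have \<delta>: "0 < \<delta>" "\<delta> * measure M (space M) < \<epsilon>"
          using that by (auto simp: \<delta>_def field_simps add_pos_nonneg add_nonneg_pos)
        have "(\<lambda>N. 4 * (V - v N) + 4 / (real N + 1)) \<longlonglongrightarrow> 4 * (V - V) + 0"
          by (intro tendsto_intros V(1)) real_asymp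
        then have "eventually (\<lambda>N. 4 * (V - v N) + 4 / (real N + 1) < \<epsilon> * \<delta>) sequentially"
          by (rule order_tendstoD) (use that \<delta> in simp)
        then obtain N where N: "4 * (V - v N) + 4 / (real N + 1) < \<epsilon> * \<delta>"
          unfolding eventually_sequentially by blast
        have "(LINT z|M. norm (g i z - g j z)) < \<epsilon>" if "N \<le> i" "N \<le> j" for i j
        proof -
          have amgm: "\<bar>h\<bar> \<le> \<delta> / 2 + h\<^sup>2 / (2 * \<delta>)" for h :: real
          proof -
            have "0 \<le> (\<bar>h\<bar> - \<delta>)\<^sup>2" by simp
            then have "2 * \<delta> * \<bar>h\<bar> \<le> \<delta>\<^sup>2 + h\<^sup>2" by (simp add: power2_diff algebra_simps)
            then show ?thesis using \<delta>(1) by (simp add: field_simps power2_eq_square)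
          qed
          have "(LINT z|M. norm (g i z - g j z)) \<le> (LINT z|M. \<delta> / 2 + (g i z - g j z)\<^sup>2 / (2 * \<delta>))"
            using amgm int_diff int_g by (intro integral_mono) auto
          also have "\<dots> = \<delta> * measure M (space M) / 2 + (LINT z|M. (g i z - g j z)\<^sup>2) / (2 * \<delta>)"
            using int_diff by simp
          also have "\<dots> < \<epsilon> / 2 + \<epsilon> * \<delta> / (2 * \<delta>)"
          proof (rule add_strict_mono)
            show "(LINT z|M. (g i z - g j z)\<^sup>2) / (2 * \<delta>) < \<epsilon> * \<delta> / (2 * \<delta>)"
              using par[OF that] N \<delta>(1) by (intro divide_strict_right_mono) auto
          qed (use \<delta> in auto)
          finally show ?thesis using \<delta>(1) by simp
        qed
        then show ?thesis by blast
      qed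
      obtain r where r: "strict_mono r" "AE x in M. Cauchy (\<lambda>i. g (r i) x)"
        using cauchy_L1_AE_cauchy_subseq[OF int_g cauchy] by blast
      \<comment> \<open>Truncation makes \<open>h\<close> a weight everywhere, also where the
        subsequence diverges; where it converges, its limit already lies between 0 and 1.\<close>
      define h where "h x = max 0 (min 1 (lim (\<lambda>i. g (r i) x)))" for x
      have hw: "h \<in> weights M"
        unfolding weights_def h_def by auto
      have "(\<lambda>i. I (g (r i))) \<longlonglongrightarrow> I h"
        unfolding I_def
      proof (rule integral_dominated_convergence[where w = "\<lambda>z. norm (f z)"])
        show "AE x in M. (\<lambda>i. g (r i) x *\<^sub>R f x) \<longlonglongrightarrow> h x *\<^sub>R f x"
          using r(2) AE_space
        proof eventually_elim
          case (elim x)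
          then have *: "(\<lambda>i. g (r i) x) \<longlonglongrightarrow> lim (\<lambda>i. g (r i) x)"
            by (simp add: Cauchy_convergent_iff convergent_LIMSEQ_iff)
          have "0 \<le> lim (\<lambda>i. g (r i) x)" "lim (\<lambda>i. g (r i) x) \<le> 1"
            using weightsD(2,3)[OF gw elim(2)]
            by (auto intro: LIMSEQ_le_const[OF *] LIMSEQ_le_const2[OF *])
          then show ?case using * by (auto simp: h_def intro!: tendsto_intros)
        qed
        show "AE x in M. norm (g (r i) x *\<^sub>R f x) \<le> norm (f x)" for i
          using weightsD(2,3)[OF gw] by (intro AE_I2) (auto intro: mult_left_le_one_le)
      qed (use fm f weightsD(1)[OF hw] in auto)
      moreover have "(\<lambda>i. I (g (r i))) \<longlonglongrightarrow> z"
      proof -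
        have "(\<lambda>i. I (g i)) \<longlonglongrightarrow> z"
        proof (rule metric_LIMSEQ_I)
          show "\<exists>N. \<forall>n\<ge>N. dist (I (g n)) z < \<epsilon>" if "0 < \<epsilon>" for \<epsilon>
          proof -
            have "(\<lambda>n. 1 / (real n + 1)) \<longlonglongrightarrow> 0" by real_asymp
            then have "eventually (\<lambda>n. 1 / (real n + 1) < \<epsilon>) sequentially"
              using that by (rule order_tendstoD)
            moreover have "dist (I (g n)) z \<le> 1 / (real n + 1)" for n using g(1)[of n] by (simp add: D_def)
            ultimately show ?thesis unfolding eventually_sequentially
              by (meson le_less_trans)
          qed
        qed
        then show ?thesis using LIMSEQ_subseq_LIMSEQ[OF _ r(1)] by (simp add: o_def)
      qed
      ultimately have "z = I h" by (rule LIMSEQ_unique[rotated])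
      then show ?thesis using hw by blast
    qed
    then show ?thesis using closure_subset_eq by blast
  qed
  ultimately show ?thesis
    unfolding compact_eq_bounded_closed I_def by blast
qed

section \<open>Points of the support and averages near them\<close>

text \<open>Otherwise every point of \<open>S\<close> has a ball of measure zero; finitely many of
  these cover the compact \<open>S\<close>, which would then have measure zero instead of
  one.\<close>

lemma compact_space_support_point:
  fixes L :: "'a::metric_space measure"
  assumes "prob_space L" "sets L = sets (restrict_space borel S)" "compact S"
  obtains z where "z \<in> S" "\<And>r. 0 < r \<Longrightarrow> 0 < measure L (ball z r \<inter> S)"
proof -
  interpret prob_space L by fact
  have sp: "space L = S" using sets_eq_imp_space_eq[OF assms(2)] by (simp add: space_restrict_space)
  have m: "ball z r \<inter> S \<in> sets L" for z r
    unfolding assms(2) sets_restrict_space by auto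
  have "\<exists>z\<in>S. \<forall>r>0. 0 < measure L (ball z r \<inter> S)"
  proof (rule ccontr)
    assume "\<not> ?thesis"
    then have "\<forall>z\<in>S. \<exists>r>0. measure L (ball z r \<inter> S) = 0"
      by (meson measure_nonneg not_less order_antisym)
    then obtain r where r: "\<And>z. z \<in> S \<Longrightarrow> 0 < r z \<and> measure L (ball z (r z) \<inter> S) = 0" by metis
    have "S \<subseteq> (\<Union>z\<in>S. ball z (r z))" using r by force
    then obtain F where F: "F \<subseteq> S" "finite F" "S \<subseteq> (\<Union>z\<in>F. ball z (r z))"
      using compactE_image[OF assms(3), of S "\<lambda>z. ball z (r z)"] by auto
    have "measure L (\<Union>z\<in>F. ball z (r z) \<inter> S) \<le> (\<Sum>z\<in>F. measure L (ball z (r z) \<inter> S))"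
      using F(2) m by (intro finite_measure_subadditive_finite) auto
    also have "\<dots> = 0" using r F(1) by (auto intro: sum.neutral)
    finally have "measure L (\<Union>z\<in>F. ball z (r z) \<inter> S) \<le> 0" .
    moreover have "(\<Union>z\<in>F. ball z (r z) \<inter> S) = space L" using F(3) sp by auto
    ultimately show False using prob_space by simp
  qed
  then show ?thesis using that by blast
qed

text \<open>Lets a point of the support act as a point mass even if it has measure zero: by
  continuity, averages over small sets around \<open>z\<close> approach the value at
  \<open>z\<close>.\<close>

lemma local_averages_tendsto:
  fixes f :: "'a::metric_space \<Rightarrow> 'b::{banach,second_countable_topology}"
  assumes "finite_measure M" and f: "integrable M f" "continuous_on (space M) f" and z: "z \<in> space M"
    and B: "\<And>n. B n \<in> sets M" "\<And>n. B n \<subseteq> ball z (1 / (real n + 1))" "\<And>n. 0 < measure M (B n)"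
  shows "(\<lambda>n. (1 / measure M (B n)) *\<^sub>R (\<integral>x. indicator (B n) x *\<^sub>R f x \<partial>M)) \<longlonglongrightarrow> f z"
proof (rule metric_LIMSEQ_I)
  interpret finite_measure M by fact
  fix \<epsilon> :: real assume "0 < \<epsilon>"
  then obtain \<delta> where \<delta>: "0 < \<delta>" "\<And>x. x \<in> space M \<Longrightarrow> dist x z < \<delta> \<Longrightarrow> dist (f x) (f z) < \<epsilon> / 2"
    using f(2) z unfolding continuous_on_iff by (metis half_gt_zero)
  have "(\<lambda>n. 1 / (real n + 1)) \<longlonglongrightarrow> 0" by real_asymp
  then have "eventually (\<lambda>n. 1 / (real n + 1) < \<delta>) sequentially"
    using \<delta>(1) by (rule order_tendstoD)
  then obtain N where N: "\<And>n. N \<le> n \<Longrightarrow> 1 / (real n + 1) < \<delta>"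
    unfolding eventually_sequentially by blast
  have "dist ((1 / measure M (B n)) *\<^sub>R (\<integral>x. indicator (B n) x *\<^sub>R f x \<partial>M)) (f z) < \<epsilon>"
    if n: "N \<le> n" for n
  proof -
    have i1: "integrable M (\<lambda>x. indicator (B n) x *\<^sub>R f x)"
      using integrable_mult_indicator[OF B(1) f(1)] .
    have i2: "integrable M (\<lambda>x. indicator (B n) x *\<^sub>R f z)"
      using integrable_mult_indicator[OF B(1), of "\<lambda>_. f z"] by simp
    have "(\<integral>x. indicator (B n) x *\<^sub>R f z \<partial>M) = measure M (B n) *\<^sub>R f z"
      using B(1) by (simp add: integral_scaleR_left emeasure_eq_measure)
    then have "(1 / measure M (B n)) *\<^sub>R (\<integral>x. indicator (B n) x *\<^sub>R f x \<partial>M) - f z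
        = (1 / measure M (B n)) *\<^sub>R (\<integral>x. indicator (B n) x *\<^sub>R f x - indicator (B n) x *\<^sub>R f z \<partial>M)"
      using B(3)[of n] by (simp add: Bochner_Integration.integral_diff[OF i1 i2] scaleR_diff_right)
    moreover have "norm (\<integral>x. indicator (B n) x *\<^sub>R f x - indicator (B n) x *\<^sub>R f z \<partial>M)
        \<le> (\<integral>x. (\<epsilon> / 2) * indicator (B n) x \<partial>M)"
    proof (rule order_trans[OF integral_norm_bound], rule integral_mono)
      show "integrable M (\<lambda>x. norm (indicator (B n) x *\<^sub>R f x - indicator (B n) x *\<^sub>R f z))"
        by (intro integrable_norm Bochner_Integration.integrable_diff i1 i2)
      show "integrable M (\<lambda>x. (\<epsilon> / 2) * indicator (B n) x)"
        using B(1) by (simp add: emeasure_eq_measure)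
      fix x assume x: "x \<in> space M"
      show "norm (indicator (B n) x *\<^sub>R f x - indicator (B n) x *\<^sub>R f z) \<le> \<epsilon> / 2 * indicator (B n) x"
      proof (cases "x \<in> B n")
        case True
        then have "dist x z < \<delta>" using B(2)[of n] N[OF n] by (force simp: dist_commute)
        then show ?thesis using True \<delta>(2)[OF x] by (simp add: dist_norm)
      qed simp
    qed
    ultimately have "norm ((1 / measure M (B n)) *\<^sub>R (\<integral>x. indicator (B n) x *\<^sub>R f x \<partial>M) - f z)
        \<le> (1 / measure M (B n)) * (\<epsilon> / 2 * measure M (B n))"
      using B(1) B(3)[of n] by (simp add: emeasure_eq_measure field_simps)
    also have "\<dots> < \<epsilon>" using B(3)[of n] \<open>0 < \<epsilon>\<close> by simp
    finally show ?thesis by (simp add: dist_norm)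
  qed
  then show "\<exists>N. \<forall>n\<ge>N. dist ((1 / measure M (B n)) *\<^sub>R (\<integral>x. indicator (B n) x *\<^sub>R f x \<partial>M)) (f z) < \<epsilon>"
    by blast
qed

section \<open>First-order conditions\<close>

text \<open>The law is carried by the closed rectangle itself: \<open>p\<close> is controlled only
  on its interval, so measurability of the integrands is obtained there, from continuity.\<close>

locale disclosure_law = prob_space L
  for L :: "(real \<times> real) measure" +
  fixes xmin xmax ymin ymax :: real and p p' :: "real \<Rightarrow> real"
  assumes sets_L: "sets L = sets (restrict_space borel ({xmin..xmax} \<times> {ymin..ymax}))"
    and ymin_nonneg: "0 \<le> ymin"
    and p_range: "\<And>x. x \<in> {xmin..xmax} \<Longrightarrow> 0 \<le> p x \<and> p x \<le> 1"
    and p_deriv: "\<And>x. x \<in> {xmin..xmax} \<Longrightarrow>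
      (p has_real_derivative p' x) (at x within {xmin..xmax})"
begin

definition moment_density :: "real \<times> real \<Rightarrow> real \<times> real \<times> real \<times> real" where
  "moment_density z = (1, fst z, snd z, snd z * p (fst z))"

definition moment :: "(real \<times> real \<Rightarrow> real) \<Rightarrow> real \<times> real \<times> real \<times> real" where
  "moment h = (\<integral>z. h z *\<^sub>R moment_density z \<partial>L)"

text \<open>The quotient is undefined at \<open>n = 0\<close>, but on \<open>moment_cone\<close>
  this forces \<open>b = c = 0\<close>, so the gain is 0 there.\<close>

definition gain :: "real \<times> real \<times> real \<times> real \<Rightarrow> real" where
  "gain = (\<lambda>(n, a, b, c). b * p (a / n) - c)"

text \<open>The derivative of \<open>gain\<close> at any \<open>(n, a, b, c)\<close> with \<open>a / n = m\<close> and \<open>b / n = r\<close>.\<close>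

definition lin_gain :: "real \<Rightarrow> real \<Rightarrow> real \<times> real \<times> real \<times> real \<Rightarrow> real" where
  "lin_gain m r = (\<lambda>(n, a, b, c). b * p m + r * p' m * (a - m * n) - c)"

text \<open>A convex cone that contains all moments together with the limits and rescalings used
  below. For positive \<open>n\<close> the mean \<open>a / n\<close> lies in the interval where
  \<open>p\<close> is controlled, and \<open>n = 0\<close> leaves only the apex.\<close>

definition moment_cone :: "(real \<times> real \<times> real \<times> real) set" where
  "moment_cone = {(n, a, b, c).
     0 \<le> n \<and> xmin * n \<le> a \<and> a \<le> xmax * n \<and> 0 \<le> b \<and> b \<le> ymax * n \<and> 0 \<le> c \<and> c \<le> ymax * n}"

definition optimal_weight :: "(real \<times> real \<Rightarrow> real) \<Rightarrow> bool" where
  "optimal_weight e \<longleftrightarrow> e \<in> weights L \<and> (\<forall>h\<in>weights L. gain (moment h) \<le> gain (moment e))"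

text \<open>Nothing is required where \<open>lin_gain\<close> vanishes, since the first-order
  condition is silent there.\<close>

definition threshold_weight :: "(real \<times> real \<Rightarrow> real) \<Rightarrow> real \<Rightarrow> real \<Rightarrow> bool" where
  "threshold_weight e m r \<longleftrightarrow> m \<in> {xmin..xmax} \<and>
     (AE z in L. (0 < lin_gain m r (moment_density z) \<longrightarrow> e z = 1) \<and>
       (lin_gain m r (moment_density z) < 0 \<longrightarrow> e z = 0))"

section \<open>Moments and their cone\<close>

lemma space_L: "space L = {xmin..xmax} \<times> {ymin..ymax}"
  using sets_eq_imp_space_eq[OF sets_L] by (simp add: space_restrict_space)

lemma measurable_L: "measurable L = measurable (restrict_space borel ({xmin..xmax} \<times> {ymin..ymax}))"
  by (rule ext) (rule measurable_cong_sets[OF sets_L refl])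

lemma continuous_on_p: "continuous_on {xmin..xmax} p"
  using p_deriv by (meson DERIV_continuous_on)

lemma continuous_on_moment_density:
  "continuous_on ({xmin..xmax} \<times> {ymin..ymax}) moment_density"
  unfolding moment_density_def
  by (intro continuous_intros continuous_on_compose2[OF continuous_on_p]) auto

lemma integrable_moment_density: "integrable L moment_density"
proof -
  have "compact (moment_density ` ({xmin..xmax} \<times> {ymin..ymax}))"
    by (intro compact_continuous_image continuous_on_moment_density compact_Times) auto
  then obtain C where "\<forall>v \<in> moment_density ` ({xmin..xmax} \<times> {ymin..ymax}). norm v \<le> C"
    using compact_imp_bounded bounded_iff by metis
  moreover have "moment_density \<in> borel_measurable L"
    unfolding measurable_L
    by (rule borel_measurable_continuous_on_restrict[OF continuous_on_moment_density])
  ultimately show ?thesis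
    by (intro integrable_const_bound[of _ C]) (auto simp: space_L intro!: AE_I2)
qed

lemma moment_cone_add: "v \<in> moment_cone \<Longrightarrow> w \<in> moment_cone \<Longrightarrow> v + w \<in> moment_cone"
  by (auto simp: moment_cone_def algebra_simps)

lemma moment_cone_scaleR: "v \<in> moment_cone \<Longrightarrow> 0 \<le> s \<Longrightarrow> s *\<^sub>R v \<in> moment_cone"
  by (auto simp: moment_cone_def mult.left_commute[of _ s] intro!: mult_left_mono)

lemma moment_density_cone: "z \<in> space L \<Longrightarrow> moment_density z \<in> moment_cone"
  using ymin_nonneg p_range[of "fst z"]
  by (auto simp: moment_cone_def moment_density_def space_L
      intro!: mult_nonneg_nonneg order_trans[OF mult_left_le])

lemma moment_cone_mean:
  assumes "(n, a, b, c) \<in> moment_cone" "0 < n"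
  shows "a / n \<in> {xmin..xmax}"
  using assms by (auto simp: moment_cone_def field_simps)

lemma moment_cone_null:
  assumes "(0, a, b, c) \<in> moment_cone"
  shows "a = 0" "b = 0" "c = 0"
  using assms by (auto simp: moment_cone_def)

lemma moment_eq:
  assumes "e \<in> weights L"
  shows "moment e = (\<integral>z. e z \<partial>L, \<integral>z. e z * fst z \<partial>L, \<integral>z. e z * snd z \<partial>L,
    \<integral>z. e z * (snd z * p (fst z)) \<partial>L)"
proof -
  note I = weighted_integrable[OF assms integrable_moment_density]
  note bl = bounded_linear_fst bounded_linear_snd bounded_linear_compose[of fst snd]
    bounded_linear_compose[of snd snd] bounded_linear_compose[of fst "\<lambda>x. snd (snd x)"]
    bounded_linear_compose[of snd "\<lambda>x. snd (snd x)"]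
  have "fst (moment e) = (\<integral>z. e z \<partial>L)"
    unfolding moment_def integral_bounded_linear[OF bounded_linear_fst I, symmetric]
    by (simp add: moment_density_def)
  moreover have "fst (snd (moment e)) = (\<integral>z. e z * fst z \<partial>L)"
    using integral_bounded_linear[OF bl(3)[OF bl(1,2)] I]
    by (simp add: moment_density_def moment_def)
  moreover have "fst (snd (snd (moment e))) = (\<integral>z. e z * snd z \<partial>L)"
    using integral_bounded_linear[OF bl(5)[OF bl(1) bl(4)[OF bl(2,2)]] I]
    by (simp add: moment_density_def moment_def)
  moreover have "snd (snd (snd (moment e))) = (\<integral>z. e z * (snd z * p (fst z)) \<partial>L)"
    using integral_bounded_linear[OF bl(6)[OF bl(2) bl(4)[OF bl(2,2)]] I]
    by (simp add: moment_density_def moment_def)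
  ultimately show ?thesis by (simp add: prod_eq_iff)
qed

lemma bounded_linear_lin_gain: "bounded_linear (lin_gain m r)"
  unfolding lin_gain_def split_beta
  by (intro bounded_linear_intros bounded_linear_compose[of fst snd]
      bounded_linear_compose[of snd snd] bounded_linear_compose[of fst "\<lambda>x. snd (snd x)"]
      bounded_linear_compose[of snd "\<lambda>x. snd (snd x)"] bounded_linear_fst bounded_linear_snd)

text \<open>A linear functional commutes with the integral, so first-order inequalities between
  moments become inequalities between integrals whose integrands can be compared pointwise.\<close>

lemma lin_gain_moment:
  assumes "e \<in> weights L"
  shows "integrable L (\<lambda>z. e z * lin_gain m r (moment_density z))"
    and "lin_gain m r (moment e) = (\<integral>z. e z * lin_gain m r (moment_density z) \<partial>L)"
proof -
  have scale: "lin_gain m r (s *\<^sub>R v) = s * lin_gain m r v" for s v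
    using linear_cmul[OF bounded_linear.linear[OF bounded_linear_lin_gain]] by simp
  note I = weighted_integrable[OF assms integrable_moment_density]
  show "integrable L (\<lambda>z. e z * lin_gain m r (moment_density z))"
    using integrable_bounded_linear[OF bounded_linear_lin_gain I, of m r] by (simp add: scale)
  show "lin_gain m r (moment e) = (\<integral>z. e z * lin_gain m r (moment_density z) \<partial>L)"
    using integral_bounded_linear[OF bounded_linear_lin_gain I, of m r]
    by (simp add: scale moment_def)
qed

lemma moment_in_cone:
  assumes "e \<in> weights L"
  shows "moment e \<in> moment_cone"
proof -
  have I: "integrable L (\<lambda>z. e z * f z)" if "integrable L f" for f
    using weighted_integrable[OF assms that] by simp
  have I1: "integrable L (\<lambda>z. fst (moment_density z))"
    "integrable L (\<lambda>z. fst (snd (moment_density z)))"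
    "integrable L (\<lambda>z. fst (snd (snd (moment_density z))))"
    "integrable L (\<lambda>z. snd (snd (snd (moment_density z))))"
    by (intro integrable_fst integrable_snd integrable_moment_density)+
  note J = I[OF I1(1)] I[OF I1(2)] I[OF I1(3)] I[OF I1(4)]
  have [simp]: "integrable L e" "integrable L (\<lambda>z. e z * fst z)" "integrable L (\<lambda>z. e z * snd z)"
    "integrable L (\<lambda>z. e z * (snd z * p (fst z)))"
    using J by (simp_all add: moment_density_def)
  have mono: "c * (\<integral>z. e z \<partial>L) \<le> (\<integral>z. e z * f z \<partial>L)"
    if "integrable L (\<lambda>z. e z * f z)" "\<And>z. z \<in> space L \<Longrightarrow> c \<le> f z" for c f
  proof -
    have "(\<integral>z. e z * c \<partial>L) \<le> (\<integral>z. e z * f z \<partial>L)"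
      using that weightsD[OF assms] by (intro integral_mono) (auto intro: mult_left_mono)
    then show ?thesis by (simp add: mult.commute)
  qed
  have mono': "(\<integral>z. e z * f z \<partial>L) \<le> c * (\<integral>z. e z \<partial>L)"
    if "integrable L (\<lambda>z. e z * f z)" "\<And>z. z \<in> space L \<Longrightarrow> f z \<le> c" for c f
    using mono[of "\<lambda>z. - f z" "- c"] that by simp
  have "0 \<le> (\<integral>z. e z \<partial>L)" using weightsD[OF assms] by (intro integral_nonneg_AE) auto
  moreover have "0 \<le> y * p x \<and> y * p x \<le> ymax" if "(x, y) \<in> space L" for x y
    using moment_density_cone[OF that] by (auto simp: moment_cone_def moment_density_def)
  ultimately show ?thesis
    using ymin_nonneg mono[of snd 0] mono[of "\<lambda>z. snd z * p (fst z)" 0]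
    unfolding moment_eq[OF assms] moment_cone_def
    by (auto simp: space_L intro!: mono mono')
qed

section \<open>Continuity and directional derivatives of the gain\<close>

lemma gain_scaleR: "0 \<le> s \<Longrightarrow> gain (s *\<^sub>R v) = s * gain v"
  by (cases "s = 0"; cases v) (auto simp: gain_def algebra_simps)

text \<open>For positive \<open>n\<close> this is continuity of \<open>p\<close>. Near the apex
  \<open>p (a / n)\<close> need not converge, but the gain is squeezed to 0.\<close>

lemma continuous_on_gain: "continuous_on moment_cone gain"
  unfolding continuous_on_sequentially
proof (intro allI ballI impI, elim conjE)
  fix u v assume u: "\<forall>k. u k \<in> moment_cone" and v: "v \<in> moment_cone" and lim: "u \<longlonglongrightarrow> v"
  obtain n a b c where v_eq: "v = (n, a, b, c)" by (cases v)
  define n' a' b' c' where "n' k = fst (u k)" and "a' k = fst (snd (u k))"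
    and "b' k = fst (snd (snd (u k)))" and "c' k = snd (snd (snd (u k)))" for k
  have u_eq: "u k = (n' k, a' k, b' k, c' k)" for k
    by (simp add: n'_def a'_def b'_def c'_def)
  have lims: "n' \<longlonglongrightarrow> n" "a' \<longlonglongrightarrow> a" "b' \<longlonglongrightarrow> b" "c' \<longlonglongrightarrow> c"
    using tendsto_fst[OF lim] tendsto_fst[OF tendsto_snd[OF lim]]
      tendsto_fst[OF tendsto_snd[OF tendsto_snd[OF lim]]]
      tendsto_snd[OF tendsto_snd[OF tendsto_snd[OF lim]]]
    by (simp_all add: n'_def[abs_def] a'_def[abs_def] b'_def[abs_def] c'_def[abs_def] v_eq)
  have uc: "(n' k, a' k, b' k, c' k) \<in> moment_cone" for k using u u_eq by metis
  show "(gain \<circ> u) \<longlonglongrightarrow> gain v"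
  proof (cases "n = 0")
    case True
    \<comment> \<open>Both terms of the gain lie between 0 and \<open>ymax * n' k\<close>.\<close>
    have gain_le: "\<bar>gain (u k)\<bar> \<le> ymax * n' k" for k
    proof (cases "n' k = 0")
      case True
      then show ?thesis using moment_cone_null[of "a' k" "b' k" "c' k"] uc[of k]
        by (simp add: gain_def u_eq)
    next
      case False
      then have "0 < n' k" using uc[of k] by (auto simp: moment_cone_def)
      from p_range[OF moment_cone_mean[OF uc this]]
      have "0 \<le> b' k * p (a' k / n' k)" "b' k * p (a' k / n' k) \<le> b' k"
        using uc[of k] by (auto simp: moment_cone_def intro: mult_left_le)
      then show ?thesis using uc[of k] by (auto simp: moment_cone_def gain_def u_eq)
    qed
    have "(\<lambda>k. ymax * n' k) \<longlonglongrightarrow> 0"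
      using tendsto_mult_left[OF lims(1), of ymax] True by simp
    then have "(\<lambda>k. gain (u k)) \<longlonglongrightarrow> 0"
      by (rule Lim_null_comparison[rotated]) (use gain_le in simp)
    moreover have "gain v = 0" using moment_cone_null[of a b c] v True by (simp add: gain_def v_eq)
    ultimately show ?thesis by (simp add: o_def)
  next
    case False
    then have n: "0 < n" using v by (auto simp: moment_cone_def v_eq)
    have ev: "eventually (\<lambda>k. a' k / n' k \<in> {xmin..xmax}) sequentially"
      using order_tendstoD(1)[OF lims(1) n]
      by eventually_elim (use uc moment_cone_mean in blast)
    have "(\<lambda>k. p (a' k / n' k)) \<longlonglongrightarrow> p (a / n)"
      using moment_cone_mean n v v_eq False
      by (intro continuous_on_tendsto_compose[OF continuous_on_p _ _ ev] tendsto_divide lims) auto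
    then have "(\<lambda>k. b' k * p (a' k / n' k) - c' k) \<longlonglongrightarrow> b * p (a / n) - c"
      by (intro tendsto_intros lims)
    then show ?thesis by (simp add: o_def u_eq gain_def v_eq)
  qed
qed

text \<open>On the segment towards \<open>v'\<close> the gain has a right derivative at 0, namely
  the difference of the two sides of the conclusion. Were it positive, the gain would rise above its
  initial value.\<close>

lemma gain_first_order:
  assumes v: "(n, a, b, c) \<in> moment_cone" "0 < n" and v': "v' \<in> moment_cone"
    and le: "\<And>t. 0 < t \<Longrightarrow> t < 1 \<Longrightarrow> gain ((1 - t) *\<^sub>R (n, a, b, c) + t *\<^sub>R v') \<le> gain (n, a, b, c)"
  shows "lin_gain (a / n) (b / n) v' \<le> gain (n, a, b, c)"
proof (rule ccontr)
  assume contr: "\<not> ?thesis"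
  obtain n' a' b' c' where v'_eq: "v' = (n', a', b', c')" by (cases v')
  define m where "m t = ((1 - t) * a + t * a') / ((1 - t) * n + t * n')" for t
  define q where "q t = ((1 - t) * b + t * b') * p (m t) - ((1 - t) * c + t * c')" for t
  have n': "0 \<le> n'" using v' by (auto simp: v'_eq moment_cone_def)
  have q_eq: "q t = gain ((1 - t) *\<^sub>R (n, a, b, c) + t *\<^sub>R v')" for t
    by (simp add: q_def m_def gain_def v'_eq)
  \<comment> \<open>The first entry of \<open>v'\<close> may be 0, so the segment is used only for
    \<open>t < 1\<close>, where the denominator stays positive.\<close>
  have pos: "0 < (1 - t) * n + t * n'" if "0 \<le> t" "t < 1" for t
    using that v(2) n' by (intro add_pos_nonneg) auto
  have m_range: "m t \<in> {xmin..xmax}" if "t \<in> {0..<1}" for t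
  proof -
    have "(1 - t) *\<^sub>R (n, a, b, c) + t *\<^sub>R v' \<in> moment_cone"
      using that v v' by (intro moment_cone_add moment_cone_scaleR) auto
    then show ?thesis unfolding m_def using that pos[of t]
      by (intro moment_cone_mean) (auto simp: v'_eq)
  qed
  have m0: "m 0 = a / n" by (simp add: m_def)
  have dm: "(m has_real_derivative (a' - m 0 * n') / n) (at 0 within {0..<1})"
    unfolding m_def using v(2)
    by (auto intro!: derivative_eq_intros simp: field_simps power2_eq_square)
  \<comment> \<open>\<open>p\<close> is differentiable only within its interval, so the chain rule
    is applied within the image of \<open>m\<close>.\<close>
  have dp: "(p \<circ> m has_real_derivative p' (m 0) * ((a' - m 0 * n') / n)) (at 0 within {0..<1})"
  proof (rule DERIV_image_chain[OF _ dm])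
    show "(p has_real_derivative p' (m 0)) (at (m 0) within m ` {0..<1})"
      using m_range by (intro DERIV_subset[OF p_deriv]) auto
  qed
  have dq: "(q has_real_derivative
      (b' - b) * p (m 0) + b * (p' (m 0) * ((a' - m 0 * n') / n)) - (c' - c)) (at 0 within {0..<1})"
    unfolding q_def using dp unfolding o_def
    by (auto intro!: derivative_eq_intros)
  \<comment> \<open>At the base point \<open>lin_gain\<close> agrees with \<open>gain\<close>,
    because \<open>a - (a / n) * n = 0\<close>; hence the derivative in direction
    \<open>v' - v\<close> is this difference.\<close>
  have "lin_gain (a / n) (b / n) v' - gain (n, a, b, c)
      = (b' - b) * p (m 0) + b * (p' (m 0) * ((a' - m 0 * n') / n)) - (c' - c)"
    using v(2) by (simp add: m0 lin_gain_def gain_def v'_eq field_simps)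
  then have "0 < (b' - b) * p (m 0) + b * (p' (m 0) * ((a' - m 0 * n') / n)) - (c' - c)"
    using contr by simp
  from has_real_derivative_pos_inc_right[OF dq this]
  obtain d where d: "0 < d" "\<And>h. 0 < h \<Longrightarrow> h < 1 \<Longrightarrow> h < d \<Longrightarrow> q 0 < q h" by auto
  have "q 0 < q (min (d / 2) (1 / 2))" using d(1) by (intro d(2)) auto
  moreover have "q (min (d / 2) (1 / 2)) \<le> q 0"
    unfolding q_eq using le[of "min (d / 2) (1 / 2)"] d(1) by simp
  ultimately show False by simp
qed

section \<open>Optimal weights: existence and threshold form\<close>

lemma optimal_weight_exists: "\<exists>e. optimal_weight e"
proof -
  have "compact (moment ` weights L)"
    unfolding moment_def by (rule compact_weighted_integrals[OF integrable_moment_density])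
  moreover have "(\<lambda>_. 0) \<in> weights L" by (simp add: weights_def)
  then have "moment ` weights L \<noteq> {}" by blast
  moreover have "continuous_on (moment ` weights L) gain"
    using moment_in_cone by (intro continuous_on_subset[OF continuous_on_gain]) auto
  ultimately obtain v where "v \<in> moment ` weights L" "\<forall>w\<in>moment ` weights L. gain w \<le> gain v"
    using continuous_attains_sup by metis
  then show ?thesis unfolding optimal_weight_def by auto
qed

lemma moment_add_scale:
  assumes "e \<in> weights L" "h \<in> weights L"
  shows "moment (\<lambda>z. s * e z + t * h z) = s *\<^sub>R moment e + t *\<^sub>R moment h"
  unfolding moment_def by (rule weighted_integral_linear[OF assms integrable_moment_density])

text \<open>Among all weights \<open>h\<close> this indicator maximizes \<open>h * lin_gain\<close>
  pointwise; it is the competitor in both first-order arguments below.\<close>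

lemma lin_gain_positive_weights: "indicator {z. 0 < lin_gain m r (moment_density z)} \<in> weights L"
proof -
  have "(\<lambda>z. lin_gain m r (moment_density z)) \<in> borel_measurable L"
    using integrable_bounded_linear[OF bounded_linear_lin_gain integrable_moment_density]
    by (rule borel_measurable_integrable)
  then have "{z \<in> space L. 0 < lin_gain m r (moment_density z)} \<in> sets L" by simp
  then show ?thesis
    by (auto simp: weights_def indicator_def borel_measurable_indicator_iff Int_def conj_commute)
qed

text \<open>Tested against the indicator \<open>h\<close>, the first-order condition bounds the
  integral of \<open>(h - e) * lin_gain\<close> by 0. This integrand is nonnegative everywhere, so
  it vanishes almost everywhere.\<close>

lemma optimal_weight_threshold:
  assumes e: "optimal_weight e" and m: "moment e = (n, a, b, c)" and n: "0 < n"
  shows "AE z in L. (0 < lin_gain (a / n) (b / n) (moment_density z) \<longrightarrow> e z = 1) \<and>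
    (lin_gain (a / n) (b / n) (moment_density z) < 0 \<longrightarrow> e z = 0)"
proof -
  let ?l = "\<lambda>z. lin_gain (a / n) (b / n) (moment_density z)"
  define h :: "real \<times> real \<Rightarrow> real" where "h = indicator {z. 0 < ?l z}"
  have ew: "e \<in> weights L" and hw: "h \<in> weights L"
    using e lin_gain_positive_weights by (auto simp: optimal_weight_def h_def)
  have "lin_gain (a / n) (b / n) (moment h) \<le> gain (moment e)"
    unfolding m
  proof (rule gain_first_order)
    show "(n, a, b, c) \<in> moment_cone" "moment h \<in> moment_cone"
      using moment_in_cone[OF ew] moment_in_cone[OF hw] m by simp_all
    fix t :: real assume "0 < t" "t < 1"
    then show "gain ((1 - t) *\<^sub>R (n, a, b, c) + t *\<^sub>R moment h) \<le> gain (n, a, b, c)"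
      using e weights_convex[OF ew hw, of t]
      unfolding m[symmetric] moment_add_scale[OF ew hw, symmetric] optimal_weight_def by auto
  qed (rule n)
  also have "gain (moment e) = lin_gain (a / n) (b / n) (moment e)"
    using n by (simp add: m gain_def lin_gain_def)
  finally have "(\<integral>z. h z * ?l z - e z * ?l z \<partial>L) \<le> 0"
    using lin_gain_moment[OF ew] lin_gain_moment[OF hw] by simp
  moreover have nonneg: "0 \<le> h z * ?l z - e z * ?l z" if "z \<in> space L" for z
    using weightsD(2,3)[OF ew that]
    by (auto simp: h_def indicator_def mult_le_0_iff intro: mult_right_le_one_le mult_left_le_one_le)
  then have "0 \<le> (\<integral>z. h z * ?l z - e z * ?l z \<partial>L)"
    by (intro integral_nonneg_AE AE_I2)
  ultimately have "(\<integral>z. h z * ?l z - e z * ?l z \<partial>L) = 0" by simp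
  then have "AE z in L. h z * ?l z - e z * ?l z = 0"
    using lin_gain_moment(1)[OF ew] lin_gain_moment(1)[OF hw] nonneg
    by (subst (asm) integral_nonneg_eq_0_iff_AE) auto
  then show ?thesis
    by eventually_elim (auto simp: h_def)
qed

text \<open>
  If disclosing everything is optimal, then non-disclosure concentrated at a point of the support
  of the law and perturbed towards an arbitrary weight is not profitable. As \<open>gain\<close> is positively
  homogeneous, the first-order condition applies at such a point mass.
\<close>

lemma full_disclosure_threshold:
  assumes opt: "\<And>h. h \<in> weights L \<Longrightarrow> gain (moment h) \<le> 0"
    and z1: "(x1, y1) \<in> space L" "\<And>r. 0 < r \<Longrightarrow> 0 < measure L (ball (x1, y1) r \<inter> space L)"
  shows "AE z in L. lin_gain x1 y1 (moment_density z) \<le> 0"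
proof -
  let ?l = "\<lambda>z. lin_gain x1 y1 (moment_density z)"
  define h :: "real \<times> real \<Rightarrow> real" where "h = indicator {z. 0 < ?l z}"
  have hw: "h \<in> weights L" unfolding h_def by (rule lin_gain_positive_weights)
  define B where "B k = ball (x1, y1) (1 / (real k + 1)) \<inter> space L" for k :: nat
  have B_sets: "B k \<in> sets L" for k
    unfolding B_def sets_L space_L sets_restrict_space
    by (rule image_eqI[of _ _ "ball (x1, y1) (1 / (real k + 1))"]) (rule Int_commute, simp)
  have B_pos: "0 < measure L (B k)" for k unfolding B_def by (rule z1) simp
  have bw: "indicator (B k) \<in> weights L" for k
    using B_sets by (auto simp: weights_def indicator_def)
  \<comment> \<open>These approach the moments of a point mass at \<open>(x1, y1)\<close>, which in
    general are not a multiple of the moments of any weight.\<close>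
  define u where "u k = (1 / measure L (B k)) *\<^sub>R moment (indicator (B k))" for k
  have u: "u \<longlonglongrightarrow> moment_density (x1, y1)"
    unfolding u_def moment_def
    by (rule local_averages_tendsto[OF finite_measure_axioms integrable_moment_density _ z1(1) B_sets _ B_pos])
      (auto simp: B_def space_L intro: continuous_on_moment_density)
  have u_cone: "u k \<in> moment_cone" for k
    unfolding u_def using moment_in_cone[OF bw] by (intro moment_cone_scaleR) auto
  have z1_gain: "gain (moment_density (x1, y1)) = 0"
    by (simp add: gain_def moment_density_def)
  have le: "gain ((1 - t) *\<^sub>R moment_density (x1, y1) + t *\<^sub>R moment h) \<le> 0" if t: "0 < t" "t < 1" for t
  proof (rule tendsto_upperbound)
    have w_cone: "(1 - t) *\<^sub>R u k + t *\<^sub>R moment h \<in> moment_cone" for k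
      using t u_cone moment_in_cone[OF hw] by (intro moment_cone_add moment_cone_scaleR) auto
    show "(\<lambda>k. gain ((1 - t) *\<^sub>R u k + t *\<^sub>R moment h))
        \<longlonglongrightarrow> gain ((1 - t) *\<^sub>R moment_density (x1, y1) + t *\<^sub>R moment h)"
      using w_cone t moment_density_cone[OF z1(1)] moment_in_cone[OF hw]
      by (intro continuous_on_tendsto_compose[OF continuous_on_gain] tendsto_intros u
          moment_cone_add moment_cone_scaleR) auto
    have "gain ((1 - t) *\<^sub>R u k + t *\<^sub>R moment h) \<le> 0" for k
    proof -
      \<comment> \<open>The coefficients of \<open>indicator (B k)\<close> and \<open>h\<close> sum
        to \<open>s\<close>. Dividing by it gives a convex combination, hence a weight, and
        homogeneity of \<open>gain\<close> absorbs the factor.\<close>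
      define s where "s = (1 - t) / measure L (B k) + t"
      have s: "0 < s" using t B_pos[of k] by (auto simp: s_def intro!: add_nonneg_pos)
      have q: "t / s \<le> 1" "0 \<le> t / s" using t B_pos[of k] s by (auto simp: s_def)
      have "(1 - t) / measure L (B k) / s = 1 - t / s"
        using s by (simp add: s_def field_simps)
      moreover have "(1 - t) *\<^sub>R u k + t *\<^sub>R moment h
          = s *\<^sub>R (((1 - t) / measure L (B k) / s) *\<^sub>R moment (indicator (B k)) + (t / s) *\<^sub>R moment h)"
        using s by (simp add: u_def scaleR_add_right)
      ultimately have "(1 - t) *\<^sub>R u k + t *\<^sub>R moment h
          = s *\<^sub>R moment (\<lambda>z. (1 - t / s) * indicator (B k) z + (t / s) * h z)"
        unfolding moment_add_scale[OF bw hw] by simp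
      then show ?thesis
        using s opt[OF weights_convex[OF bw hw q(2,1)]]
        by (simp add: gain_scaleR mult_le_0_iff)
    qed
    then show "\<forall>\<^sub>F k in sequentially. gain ((1 - t) *\<^sub>R u k + t *\<^sub>R moment h) \<le> 0" by simp
  qed simp
  \<comment> \<open>The point mass has \<open>n = 1\<close>, so its averages are \<open>x1\<close>
    and \<open>y1\<close>.\<close>
  have "lin_gain (x1 / 1) (y1 / 1) (moment h) \<le> gain (1, x1, y1, y1 * p x1)"
  proof (rule gain_first_order)
    show "(1, x1, y1, y1 * p x1) \<in> moment_cone"
      using moment_density_cone[OF z1(1)] by (simp add: moment_density_def)
  qed (use le z1_gain moment_in_cone[OF hw] in \<open>simp_all add: moment_density_def\<close>)
  then have "(\<integral>z. h z * ?l z \<partial>L) \<le> 0"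
    using z1_gain lin_gain_moment[OF hw] by (simp add: moment_density_def)
  moreover have nonneg: "0 \<le> h z * ?l z" for z
    by (auto simp: h_def indicator_def)
  then have "0 \<le> (\<integral>z. h z * ?l z \<partial>L)" by simp
  ultimately have "(\<integral>z. h z * ?l z \<partial>L) = 0" by simp
  then have "AE z in L. h z * ?l z = 0"
    using lin_gain_moment(1)[OF hw] nonneg by (subst (asm) integral_nonneg_eq_0_iff_AE) auto
  then show ?thesis
    by eventually_elim (auto simp: h_def indicator_def split: if_splits)
qed

text \<open>
  When (almost) everything is disclosed, the pair \<open>(x1, y1)\<close> takes the place of the undefined
  averages over non-disclosure.
\<close>

lemma optimal_weight_first_order:
  obtains x1 y1 where "x1 \<in> {xmin..xmax}" "y1 \<in> {ymin..ymax}"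
    "\<And>e. optimal_weight e \<Longrightarrow> (case moment e of (n, a, b, c) \<Rightarrow>
      threshold_weight e (if n = 0 then x1 else a / n) (if n = 0 then y1 else b / n))"
proof -
  \<comment> \<open>The support point is chosen before \<open>e\<close>, so one pair serves every
    optimal weight.\<close>
  obtain z1 where z1: "z1 \<in> space L" "\<And>r. 0 < r \<Longrightarrow> 0 < measure L (ball z1 r \<inter> space L)"
    using compact_space_support_point[OF prob_space_axioms sets_L]
    by (auto simp: space_L compact_Times)
  obtain x1 y1 where z1_eq: "z1 = (x1, y1)" by (cases z1)
  show thesis
  proof (rule that[of x1 y1])
    show "x1 \<in> {xmin..xmax}" "y1 \<in> {ymin..ymax}" using z1(1) by (auto simp: z1_eq space_L)
    fix e assume e: "optimal_weight e"
    obtain n a b c where mom: "moment e = (n, a, b, c)" by (metis prod_cases4)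
    have ew: "e \<in> weights L" using e by (simp add: optimal_weight_def)
    have cone: "(n, a, b, c) \<in> moment_cone" using moment_in_cone[OF ew] mom by simp
    show "case moment e of (n, a, b, c) \<Rightarrow>
      threshold_weight e (if n = 0 then x1 else a / n) (if n = 0 then y1 else b / n)"
    proof (cases "n = 0")
      case True
      \<comment> \<open>The maximal gain is therefore 0, which is the premise of
        \<open>full_disclosure_threshold\<close>.\<close>
      have "gain (moment e) = 0" using moment_cone_null[of a b c] cone mom True by (simp add: gain_def)
      then have "AE z in L. lin_gain x1 y1 (moment_density z) \<le> 0"
        using e z1 by (intro full_disclosure_threshold) (auto simp: optimal_weight_def z1_eq)
      moreover have "(\<integral>z. e z \<partial>L) = 0" using mom moment_eq[OF ew] True by simp
      then have "AE z in L. e z = 0"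
        using weighted_integrable[OF ew, of "\<lambda>_. 1::real"] weightsD[OF ew]
        by (subst (asm) integral_nonneg_eq_0_iff_AE) auto
      ultimately have "AE z in L. (0 < lin_gain x1 y1 (moment_density z) \<longrightarrow> e z = 1) \<and>
        (lin_gain x1 y1 (moment_density z) < 0 \<longrightarrow> e z = 0)"
        by eventually_elim auto
      then show ?thesis using True z1(1) by (simp add: mom threshold_weight_def z1_eq space_L)
    next
      case False
      then have "0 < n" using cone by (auto simp: moment_cone_def)
      then show ?thesis
        using optimal_weight_threshold[OF e mom] moment_cone_mean[OF cone] False
        by (simp add: mom threshold_weight_def)
    qed
  qed
qed

end

section \<open>Disclosure rules as weights\<close>

definition nd_weight :: "(real \<Rightarrow> real \<Rightarrow> real) \<Rightarrow> real \<times> real \<Rightarrow> real" where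
  "nd_weight d z = 1 - d (fst z) (snd z)"

context disclosure_model
begin

text \<open>The target carries the trace sigma-algebra of the rectangle, the one for which
  disclosure rules are measurable.\<close>

definition law :: "(real \<times> real) measure" where
  "law = distr M (restrict_space borel (X \<times> Y)) (\<lambda>w. (sig w, prof w))"

lemma signal_measurable:
  "(\<lambda>w. (sig w, prof w)) \<in> M \<rightarrow>\<^sub>M restrict_space borel (X \<times> Y)"
  using sig_measurable prof_measurable sig_range prof_range
  by (auto intro!: measurable_restrict_space2)

lemma p_continuous_on: "continuous_on X p"
  using p_deriv by (meson DERIV_continuous_on)

sublocale law: disclosure_law law xmin xmax ymin ymax p p'
proof -
  have "prob_space law"
    unfolding law_def using signal_measurable by (rule prob_space_distr)
  moreover have "sets law = sets (restrict_space borel ({xmin..xmax} \<times> {ymin..ymax}))"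
    unfolding law_def sets_distr by (simp only: X_eq Y_eq)
  ultimately show "disclosure_law law xmin xmax ymin ymax p p'"
    using ymin_nonneg p_range p_deriv
    by (auto simp: disclosure_law_def disclosure_law_axioms_def X_eq Pi_iff)
qed

lemma space_law: "space law = X \<times> Y"
  using law.space_L by (simp add: X_eq Y_eq)

lemma measurable_law: "measurable law = measurable (restrict_space borel (X \<times> Y))"
  using law.measurable_L by (simp add: X_eq Y_eq)

section \<open>Disintegration of the joint law\<close>

lemma kernel_measurable:
  "(\<lambda>y. distr (K y) (borel \<Otimes>\<^sub>M borel) (\<lambda>x. (x, y))) \<in> FY \<rightarrow>\<^sub>M subprob_algebra (borel \<Otimes>\<^sub>M borel)"
proof -
  have "K \<in> FY \<rightarrow>\<^sub>M subprob_algebra borel"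
    using measurable_prob_algebraD[OF K_kernel] by (simp add: FY_eq cong: measurable_cong_sets)
  then show ?thesis
    by (intro measurable_distr2[where M = borel]) (simp_all add: FY_eq measurable_split_conv)
qed

lemma pair_measurable_K: "(\<lambda>x. (x, y)) \<in> K y \<rightarrow>\<^sub>M borel \<Otimes>\<^sub>M borel"
proof -
  have "sets (K y) = sets borel"
    using measurable_space[OF K_kernel, of y] by (auto simp: space_prob_algebra)
  then have "measurable (K y) (borel \<Otimes>\<^sub>M borel) = borel \<rightarrow>\<^sub>M (borel \<Otimes>\<^sub>M borel :: (real \<times> real) measure)"
    by (intro measurable_cong_sets refl)
  then show ?thesis by simp
qed

text \<open>\<open>K_conditional\<close> writes the joint law as a bind, and a property holding
  almost everywhere for a bind holds in the nested sense.\<close>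

lemma iterated_AE:
  assumes P: "Measurable.pred borel P" and AE: "AE w in M. P (sig w, prof w)"
  shows "AE y in FY. AE x in K y. P (x, y)"
proof -
  have P': "Measurable.pred (borel \<Otimes>\<^sub>M borel) P" using P by (simp add: borel_prod)
  have "AE z in distr M (borel \<Otimes>\<^sub>M borel) (\<lambda>w. (sig w, prof w)). P z"
    using AE P' sig_measurable prof_measurable by (subst AE_distr_iff) auto
  then have "AE y in FY. AE z in distr (K y) (borel \<Otimes>\<^sub>M borel) (\<lambda>x. (x, y)). P z"
    unfolding K_conditional using AE_bind[OF kernel_measurable P'] by simp
  then show ?thesis
    by eventually_elim (rule AE_distrD[OF pair_measurable_K])
qed

text \<open>\<open>P\<close> need not be measurable, so a measurable null set containing its
  failures replaces it. Membership in the rectangle is recorded because the model does not place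
  \<open>K y\<close> on \<open>X\<close> for every single \<open>y\<close>.\<close>

lemma iterated_AE_law:
  assumes "AE z in law. P z"
  shows "AE y in FY. AE x in K y. x \<in> X \<and> y \<in> Y \<and> P (x, y)"
proof -
  obtain N where N: "{z \<in> space law. \<not> P z} \<subseteq> N" "emeasure law N = 0" "N \<in> sets law"
    using assms by (rule AE_E)
  have borel: "X \<times> Y \<in> sets borel"
    unfolding X_eq Y_eq by (intro borel_closed closed_Times) auto
  then have "N \<in> sets borel"
    using N(3) by (auto simp: law_def sets_restrict_space)
  then have "X \<times> Y - N \<in> sets borel" using borel by blast
  moreover have "AE z in law. z \<notin> N" using N by (intro AE_not_in) auto
  then have "AE w in M. (sig w, prof w) \<notin> N"
    unfolding law_def by (rule AE_distrD[OF signal_measurable])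
  then have "AE w in M. (sig w, prof w) \<in> X \<times> Y - N"
    using AE_space by eventually_elim (auto simp: sig_range prof_range)
  ultimately have "AE y in FY. AE x in K y. (x, y) \<in> X \<times> Y - N"
    by (intro iterated_AE[of "\<lambda>z. z \<in> X \<times> Y - N"]) (simp_all only: pred_def space_borel UNIV_I simp_thms Collect_mem_eq)
  then show ?thesis
  proof eventually_elim
    case (elim y)
    then show ?case
      by eventually_elim (use N(1) in \<open>auto simp: space_law\<close>)
  qed
qed

lemma iterated_integral:
  fixes g :: "real \<times> real \<Rightarrow> real"
  assumes g: "g \<in> borel_measurable law" and C: "\<And>z. z \<in> X \<times> Y \<Longrightarrow> \<bar>g z\<bar> \<le> C"
  shows "(LINT y:Y|FY. (LINT x:X|K y. g (x, y))) = (\<integral>z. g z \<partial>law)"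
proof -
  \<comment> \<open>\<open>g\<close> is measurable only on the rectangle; extension by zero carries
    it to the whole plane, where the kernels live.\<close>
  define h where "h z = indicator (X \<times> Y) z *\<^sub>R g z" for z
  have borel: "X \<times> Y \<in> sets borel"
    unfolding X_eq Y_eq by (intro borel_closed closed_Times) auto
  have h: "h \<in> borel_measurable (borel \<Otimes>\<^sub>M borel)"
    using g borel unfolding h_def measurable_law
    by (simp add: borel_prod borel_measurable_restrict_space_iff)
  have "(\<integral>z. g z \<partial>law) = (\<integral>w. g (sig w, prof w) \<partial>M)"
    unfolding law_def using signal_measurable g
    by (intro integral_distr) (simp_all add: measurable_law)
  also have "\<dots> = (\<integral>w. h (sig w, prof w) \<partial>M)"
    using sig_range prof_range by (intro Bochner_Integration.integral_cong) (auto simp: h_def)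
  also have "\<dots> = (\<integral>z. h z \<partial>distr M (borel \<Otimes>\<^sub>M borel) (\<lambda>w. (sig w, prof w)))"
    using h sig_measurable prof_measurable by (intro integral_distr[symmetric]) auto
  also have "\<dots> = (\<integral>y. (\<integral>z. h z \<partial>distr (K y) (borel \<Otimes>\<^sub>M borel) (\<lambda>x. (x, y))) \<partial>FY)"
    unfolding K_conditional
  \<comment> \<open>The maximum with 0 also bounds \<open>h\<close> off the rectangle.\<close>
  proof (rule integral_bind[where B' = 1 and B = "max C 0", OF h _ kernel_measurable])
    show "finite_measure FY"
      using finite_measure_distr[OF prof_measurable] by (simp add: FY_eq)
    show "AE y in FY. emeasure (distr (K y) (borel \<Otimes>\<^sub>M borel) (\<lambda>x. (x, y)))
        (space (distr (K y) (borel \<Otimes>\<^sub>M borel) (\<lambda>x. (x, y)))) \<le> ennreal 1"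
      using measurable_space[OF kernel_measurable] subprob_space.emeasure_space_le_1
      unfolding space_subprob_algebra ennreal_1 by (intro AE_I2) blast
    show "\<bar>h z\<bar> \<le> max C 0" for z
      using C[of z] by (auto simp: h_def indicator_def)
  qed
  also have "\<dots> = (\<integral>y. (\<integral>x. h (x, y) \<partial>K y) \<partial>FY)"
    by (intro Bochner_Integration.integral_cong refl integral_distr[OF pair_measurable_K h])
  also have "\<dots> = (LINT y:Y|FY. (LINT x:X|K y. g (x, y)))"
    unfolding set_lebesgue_integral_def
  proof (intro Bochner_Integration.integral_cong refl)
    fix y
    show "(\<integral>x. h (x, y) \<partial>K y) = indicator Y y *\<^sub>R (\<integral>x. indicator X x *\<^sub>R g (x, y) \<partial>K y)"
      by (simp add: h_def indicator_times mult.assoc mult.left_commute flip: integral_mult_right_zero)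
  qed
  finally show ?thesis by simp
qed

section \<open>Profit as the gain of the moments\<close>

lemma nd_weight_iff: "disclosure_rule X Y d \<longleftrightarrow> nd_weight d \<in> weights law"
proof -
  define f where "f = (\<lambda>(x, y). d x y)"
  have eq: "f = (\<lambda>z. 1 - nd_weight d z)" "nd_weight d = (\<lambda>z. 1 - f z)"
    by (auto simp: nd_weight_def f_def fun_eq_iff)
  have "f \<in> borel_measurable law \<longleftrightarrow> nd_weight d \<in> borel_measurable law"
  proof
    show "nd_weight d \<in> borel_measurable law" if "f \<in> borel_measurable law"
      unfolding eq(2) using that by simp
    show "f \<in> borel_measurable law" if "nd_weight d \<in> borel_measurable law"
      unfolding eq(1) using that by simp
  qed
  then show ?thesis
    unfolding f_def disclosure_rule_def weights_def measurable_law[symmetric]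
    by (auto simp: space_law nd_weight_def)
qed

lemma rule_moments:
  assumes d: "disclosure_rule X Y d" and m: "law.moment (nd_weight d) = (n, a, b, c)"
  shows "nd_mass X Y FY K d = n"
    and "x_nd X Y FY K x0 d = (if n = 0 then x0 else a / n)"
    and "y_nd X Y FY K y0 d = (if n = 0 then y0 else b / n)"
proof -
  have w: "nd_weight d \<in> weights law" using d by (simp add: nd_weight_iff)
  note [measurable] = weightsD(1)[OF w]
  have e: "0 \<le> 1 - d x y" "1 - d x y \<le> 1" if "x \<in> X" "y \<in> Y" for x y
    using weightsD(2,3)[OF w, of "(x, y)"] that by (auto simp: nd_weight_def space_law)
  have ew: "0 \<le> nd_weight d z" "nd_weight d z \<le> 1" if "z \<in> X \<times> Y" for z
    using weightsD(2,3)[OF w, of z] that by (auto simp: space_law)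
  have fm: "fst \<in> borel_measurable law" "snd \<in> borel_measurable law"
    unfolding measurable_law
    by (auto intro!: borel_measurable_continuous_on_restrict continuous_intros)
  note [measurable] = fm
  have n: "(\<integral>z. nd_weight d z \<partial>law) = n" and a: "(\<integral>z. nd_weight d z * fst z \<partial>law) = a"
    and b: "(\<integral>z. nd_weight d z * snd z \<partial>law) = b"
    using m law.moment_eq[OF w] by auto
  show mass: "nd_mass X Y FY K d = n"
    using iterated_integral[of "nd_weight d" 1] e n by (force simp: nd_mass_def nd_weight_def)
  have "(LINT y:Y|FY. (LINT x:X|K y. nd_weight d (x, y) * fst (x, y))) = a"
    unfolding a[symmetric]
  proof (rule iterated_integral)
    fix z assume "z \<in> X \<times> Y"
    then show "\<bar>nd_weight d z * fst z\<bar> \<le> \<bar>xmin\<bar> + \<bar>xmax\<bar>"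
      using ew[of z] mult_left_le_one_le[of "\<bar>fst z\<bar>" "nd_weight d z"]
      by (auto simp: X_eq abs_mult)
  qed simp
  then show "x_nd X Y FY K x0 d = (if n = 0 then x0 else a / n)"
    by (simp add: x_nd_def mass nd_weight_def mult.commute)
  have "(LINT y:Y|FY. (LINT x:X|K y. nd_weight d (x, y) * snd (x, y))) = b"
    unfolding b[symmetric]
  proof (rule iterated_integral)
    fix z assume "z \<in> X \<times> Y"
    then show "\<bar>nd_weight d z * snd z\<bar> \<le> \<bar>ymin\<bar> + \<bar>ymax\<bar>"
      using ew[of z] mult_left_le_one_le[of "\<bar>snd z\<bar>" "nd_weight d z"]
      by (auto simp: Y_eq abs_mult)
  qed simp
  then show "y_nd X Y FY K y0 d = (if n = 0 then y0 else b / n)"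
    by (simp add: y_nd_def mass nd_weight_def mult.commute)
qed

text \<open>In terms of \<open>e = 1 - d\<close> the integrand splits into \<open>y * p x\<close>,
  which is free of the rule, and terms that integrate to \<open>b * p (a / n) - c\<close>.\<close>

lemma profit_eq_gain:
  assumes d: "disclosure_rule X Y d" and x0: "x0 \<in> X"
  shows "profit X Y FY K p x0 d
    = (\<integral>z. snd z * p (fst z) \<partial>law) + law.gain (law.moment (nd_weight d))"
proof -
  have w: "nd_weight d \<in> weights law" using d by (simp add: nd_weight_iff)
  obtain n a b c where m: "law.moment (nd_weight d) = (n, a, b, c)" by (metis prod_cases4)
  have cone: "(n, a, b, c) \<in> law.moment_cone" using law.moment_in_cone[OF w] m by simp
  define xn where "xn = x_nd X Y FY K x0 d"
  have xn_eq: "xn = (if n = 0 then x0 else a / n)"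
    unfolding xn_def by (rule rule_moments(2)[OF d m])
  have xn: "xn \<in> X"
    using x0 law.moment_cone_mean[OF cone] cone
    by (auto simp: xn_eq X_eq law.moment_cone_def less_le)
  define g where "g z = snd z * p (fst z) + p xn * (nd_weight d z * snd z)
    - nd_weight d z * (snd z * p (fst z))" for z
  have cont: "continuous_on (X \<times> Y) (\<lambda>z. snd z * p (fst z))"
    by (intro continuous_intros continuous_on_compose2[OF p_continuous_on]) auto
  have int: "integrable law f" if "continuous_on (X \<times> Y) f" for f :: "real \<times> real \<Rightarrow> real"
  proof -
    have "compact (f ` (X \<times> Y))"
      using that by (intro compact_continuous_image compact_Times) (auto simp: X_eq Y_eq)
    then obtain C where "\<forall>v \<in> f ` (X \<times> Y). norm v \<le> C"
      using compact_imp_bounded bounded_iff by metis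
    then show ?thesis
      using borel_measurable_continuous_on_restrict[OF that]
      by (intro law.integrable_const_bound[of _ C])
        (auto simp: space_law measurable_law intro!: AE_I2)
  qed
  note i1 = int[OF cont]
  have i2: "integrable law (\<lambda>z. nd_weight d z * snd z)"
    using weighted_integrable[OF w int[of snd]] by (simp add: continuous_on_snd)
  have i3: "integrable law (\<lambda>z. nd_weight d z * (snd z * p (fst z)))"
    using weighted_integrable[OF w i1] by simp
  have g_eq: "g (x, y) = y * (d x y * p x + (1 - d x y) * p xn)" for x y
    by (simp add: g_def nd_weight_def algebra_simps)
  have bound: "\<bar>g z\<bar> \<le> ymax" if zXY: "z \<in> X \<times> Y" for z
  proof -
    obtain x y where z: "z = (x, y)" "x \<in> X" "y \<in> Y" using zXY by blast
    have "0 \<le> d x y" "d x y \<le> 1" using d z by (auto simp: disclosure_rule_def)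
    moreover have "0 \<le> p x" "p x \<le> 1" "0 \<le> p xn" "p xn \<le> 1" using p_range z xn by auto
    ultimately have "0 \<le> d x y * p x + (1 - d x y) * p xn" "d x y * p x + (1 - d x y) * p xn \<le> 1"
      by (auto intro: convex_bound_le)
    moreover have "0 \<le> y" "y \<le> ymax" using z ymin_nonneg by (auto simp: Y_eq)
    ultimately have "0 \<le> g z" "g z \<le> y" unfolding z(1) g_eq by (auto intro: mult_left_le)
    then show ?thesis using \<open>y \<le> ymax\<close> by simp
  qed
  have "profit X Y FY K p x0 d = (LINT y:Y|FY. (LINT x:X|K y. g (x, y)))"
    unfolding profit_def sale_prob_def xn_def[symmetric] g_eq by simp
  also have "\<dots> = (\<integral>z. g z \<partial>law)"
    using i1 i2 i3 bound by (intro iterated_integral) (auto simp: g_def[abs_def])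
  also have "\<dots> = (\<integral>z. snd z * p (fst z) \<partial>law) + (p xn * b - c)"
    using i1 i2 i3 m law.moment_eq[OF w] by (simp add: g_def[abs_def])
  \<comment> \<open>If \<open>n = 0\<close>, then \<open>xn\<close> is \<open>x0\<close> while
    \<open>gain\<close> uses \<open>a / 0\<close>; both sides are 0 because
    \<open>b = c = 0\<close>.\<close>
  also have "p xn * b - c = law.gain (law.moment (nd_weight d))"
    using law.moment_cone_null[of a b c] cone by (auto simp: m law.gain_def xn_eq)
  finally show ?thesis by simp
qed

text \<open>Profit and gain differ by a constant, and every weight \<open>h\<close> is the
  \<open>nd_weight\<close> of the rule \<open>1 - h\<close>. In particular the optimal rules are the
  same for every \<open>x0\<close> in \<open>X\<close>.\<close>

lemma optimal_rule_iff:
  assumes x0: "x0 \<in> X"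
  shows "optimal_rule X Y FY K p x0 d \<longleftrightarrow> law.optimal_weight (nd_weight d)"
proof -
  have "(\<forall>d'. disclosure_rule X Y d' \<longrightarrow> law.gain (law.moment (nd_weight d')) \<le> g) \<longleftrightarrow>
      (\<forall>h\<in>weights law. law.gain (law.moment h) \<le> g)" for g
  proof (intro iffI ballI allI impI)
    fix h assume all: "\<forall>d'. disclosure_rule X Y d' \<longrightarrow> law.gain (law.moment (nd_weight d')) \<le> g"
      and h: "h \<in> weights law"
    have "nd_weight (\<lambda>x y. 1 - h (x, y)) = h" by (simp add: nd_weight_def fun_eq_iff)
    then show "law.gain (law.moment h) \<le> g" using all h nd_weight_iff by metis
  qed (simp add: nd_weight_iff)
  then show ?thesis
    unfolding optimal_rule_def law.optimal_weight_def nd_weight_iff[symmetric]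
    by (simp add: profit_eq_gain x0 cong: conj_cong)
qed

lemma optimal_rule_exists:
  assumes "x0 \<in> X"
  shows "\<exists>d. optimal_rule X Y FY K p x0 d"
proof -
  obtain e where "law.optimal_weight e" using law.optimal_weight_exists by blast
  moreover have "nd_weight (\<lambda>x y. 1 - e (x, y)) = e" by (simp add: nd_weight_def fun_eq_iff)
  ultimately show ?thesis using optimal_rule_iff[OF assms] by metis
qed

section \<open>The threshold profitability\<close>

text \<open>Truncation makes this a map into \<open>Y\<close>. The value \<open>ymin\<close> at
  \<open>m\<close>, where the quotient is 0/0, and off \<open>X\<close> is a placeholder.\<close>

definition ybar :: "real \<Rightarrow> real \<Rightarrow> real \<Rightarrow> real" where
  "ybar m r x = (if x \<in> X - {m}
     then max ymin (min ymax (r * (p' m * (m - x) / (p m - p x)))) else ymin)"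

lemma p_inj: "x \<in> X \<Longrightarrow> m \<in> X \<Longrightarrow> p m = p x \<longleftrightarrow> m = x"
  using strict_mono_on_imp_inj_on[OF p_strict_mono] by (auto dest: inj_onD)

text \<open>Makes the graph of \<open>ybar m r\<close> one of the null graphs in
  \<open>tie_free\<close>. The denominator is nonzero on \<open>X - {m}\<close> because
  \<open>p\<close> is injective.\<close>

lemma ybar_measurable:
  assumes "m \<in> X"
  shows "ybar m r \<in> borel_measurable borel"
proof -
  have "continuous_on (X - {m}) (\<lambda>x. max ymin (min ymax (r * (p' m * (m - x) / (p m - p x)))))"
    using assms p_inj
    by (intro continuous_intros continuous_on_subset[OF p_continuous_on]) auto
  moreover have "X - {m} \<in> sets borel" by (simp add: X_eq)
  ultimately show ?thesis
    unfolding ybar_def by (intro borel_measurable_continuous_on_if continuous_on_const)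
qed

text \<open>\<open>lin_gain\<close> factors as \<open>(p m - p x) * (y - \<psi>)\<close> with \<psi>
  the untruncated threshold. The first factor has the sign of \<open>m - x\<close>, and any
  \<open>y\<close> in \<open>Y\<close> strictly on one side of the truncated threshold is on the
  same side of \<psi>.\<close>

lemma lin_gain_sign:
  assumes x: "x \<in> X" "m \<in> X" "x \<noteq> m" and y: "y \<in> Y" "y \<noteq> ybar m r x"
  shows "0 \<le> (x - m) * (y - ybar m r x) \<longleftrightarrow> law.lin_gain m r (law.moment_density (x, y)) < 0"
    and "law.lin_gain m r (law.moment_density (x, y)) \<noteq> 0"
proof -
  define \<psi> where "\<psi> = r * (p' m * (m - x) / (p m - p x))"
  have ne: "p m - p x \<noteq> 0" using p_inj x by auto
  have lin: "law.lin_gain m r (law.moment_density (x, y)) = (p m - p x) * (y - \<psi>)"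
    using ne by (simp add: law.lin_gain_def law.moment_density_def \<psi>_def field_simps)
  have yb: "ybar m r x = max ymin (min ymax \<psi>)" using x by (simp add: ybar_def \<psi>_def)
  have cmp: "y < ybar m r x \<Longrightarrow> y < \<psi>" "ybar m r x < y \<Longrightarrow> \<psi> < y"
    using y by (auto simp: yb Y_eq)
  have mono: "x < m \<Longrightarrow> p x < p m" "m < x \<Longrightarrow> p m < p x"
    using strict_mono_onD[OF p_strict_mono] x by auto
  show "0 \<le> (x - m) * (y - ybar m r x) \<longleftrightarrow> law.lin_gain m r (law.moment_density (x, y)) < 0"
    using cmp mono x(3) y(2) unfolding lin zero_le_mult_iff mult_less_0_iff
    by (cases "x < m"; cases "y < ybar m r x") auto
  show "law.lin_gain m r (law.moment_density (x, y)) \<noteq> 0"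
    using ne cmp y(2) unfolding lin by (auto simp: not_less_iff_gr_or_eq neq_iff)
qed

text \<open>At \<open>x = m\<close> \<open>lin_gain\<close> vanishes for every \<open>y\<close>. At
  \<open>y = ybar m r x\<close> the product is 0 and would prescribe disclosure, whereas
  \<open>lin_gain\<close> may vanish or, after truncation, even be positive. Hence the two
  exceptions.\<close>

definition threshold_rule :: "(real \<Rightarrow> real \<Rightarrow> real) \<Rightarrow> real \<Rightarrow> real \<Rightarrow> bool" where
  "threshold_rule d m r \<longleftrightarrow> m \<in> X \<and>
     (AE y in FY. AE x in K y. x \<noteq> m \<and> y \<noteq> ybar m r x \<longrightarrow>
        d x y \<in> {0, 1} \<and> (d x y = 1 \<longleftrightarrow> 0 \<le> (x - m) * (y - ybar m r x)))"

lemma threshold_ruleI: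
  assumes "law.threshold_weight (nd_weight d) m r"
  shows "threshold_rule d m r"
proof -
  let ?l = "\<lambda>x y. law.lin_gain m r (law.moment_density (x, y))"
  have mX: "m \<in> X" and AE: "AE z in law.
      (0 < law.lin_gain m r (law.moment_density z) \<longrightarrow> nd_weight d z = 1) \<and>
      (law.lin_gain m r (law.moment_density z) < 0 \<longrightarrow> nd_weight d z = 0)"
    using assms unfolding law.threshold_weight_def X_eq[symmetric] by blast+
  have thr: "d x y \<in> {0, 1} \<and> (d x y = 1 \<longleftrightarrow> 0 \<le> (x - m) * (y - ybar m r x))"
    if "x \<in> X" "y \<in> Y" "0 < ?l x y \<longrightarrow> nd_weight d (x, y) = 1"
      "?l x y < 0 \<longrightarrow> nd_weight d (x, y) = 0" "x \<noteq> m" "y \<noteq> ybar m r x" for x y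
    using lin_gain_sign[OF that(1) mX that(5,2,6)] that(3,4)
    by (cases "?l x y < 0") (auto simp: nd_weight_def)
  have "AE y in FY. AE x in K y. x \<noteq> m \<and> y \<noteq> ybar m r x \<longrightarrow>
        d x y \<in> {0, 1} \<and> (d x y = 1 \<longleftrightarrow> 0 \<le> (x - m) * (y - ybar m r x))"
    using iterated_AE_law[OF AE]
  proof eventually_elim
    case (elim y)
    then show ?case by eventually_elim (use thr in blast)
  qed
  then show ?thesis using mX by (simp add: threshold_rule_def)
qed

text \<open>Without non-disclosure the averages take conventional values; the premise on
  \<open>nd_mass\<close> sets them to the support point, where the first-order condition
  holds.\<close>

lemma optimal_rule_threshold:
  obtains x1 y1 where "x1 \<in> X" "y1 \<in> Y"
    "\<And>x0 y0 d. x0 \<in> X \<Longrightarrow> optimal_rule X Y FY K p x0 d \<Longrightarrow>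
      nd_mass X Y FY K d = 0 \<longrightarrow> x0 = x1 \<and> y0 = y1 \<Longrightarrow>
      threshold_rule d (x_nd X Y FY K x0 d) (y_nd X Y FY K y0 d)"
proof (rule law.optimal_weight_first_order)
  fix x1 y1
  assume xy1: "x1 \<in> {xmin..xmax}" "y1 \<in> {ymin..ymax}" and
    fo: "\<And>e. law.optimal_weight e \<Longrightarrow> (case law.moment e of (n, a, b, c) \<Rightarrow>
      law.threshold_weight e (if n = 0 then x1 else a / n) (if n = 0 then y1 else b / n))"
  show thesis
  proof (rule that)
    show "x1 \<in> X" "y1 \<in> Y" using xy1 by (simp_all add: X_eq Y_eq)
    fix x0 y0 d
    assume x0: "x0 \<in> X" and opt: "optimal_rule X Y FY K p x0 d"
      and triv: "nd_mass X Y FY K d = 0 \<longrightarrow> x0 = x1 \<and> y0 = y1"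
    have d: "disclosure_rule X Y d" using opt by (simp add: optimal_rule_def)
    obtain n a b c where mom: "law.moment (nd_weight d) = (n, a, b, c)" by (metis prod_cases4)
    have "law.threshold_weight (nd_weight d) (if n = 0 then x1 else a / n) (if n = 0 then y1 else b / n)"
      using fo[of "nd_weight d"] opt optimal_rule_iff[OF x0] by (simp add: mom)
    moreover have "x_nd X Y FY K x0 d = (if n = 0 then x1 else a / n)"
      "y_nd X Y FY K y0 d = (if n = 0 then y1 else b / n)"
      using triv unfolding rule_moments[OF d mom] by auto
    ultimately show "threshold_rule d (x_nd X Y FY K x0 d) (y_nd X Y FY K y0 d)"
      using threshold_ruleI by simp
  qed
qed

text \<open>Removes the two exceptions of \<open>threshold_rule\<close>, taking for \<open>g\<close>
  the threshold and for \<open>c\<close> the point \<open>m\<close>.\<close>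

lemma tie_free_AE:
  assumes "tie_free M sig prof" "g \<in> borel_measurable borel"
  shows "AE y in FY. AE x in K y. x \<noteq> c \<and> y \<noteq> g x"
proof -
  have "AE w in M. sig w \<noteq> c" "AE w in M. prof w \<noteq> g (sig w)"
    using assms by (auto simp: tie_free_def)
  then have "AE w in M. fst (sig w, prof w) \<noteq> c \<and> snd (sig w, prof w) \<noteq> g (fst (sig w, prof w))"
    by eventually_elim simp
  moreover have "Measurable.pred borel (\<lambda>z :: real \<times> real. fst z \<noteq> c \<and> snd z \<noteq> g (fst z))"
    unfolding borel_prod[symmetric] using assms(2) by measurable
  ultimately have "AE y in FY. AE x in K y. fst (x, y) \<noteq> c \<and> snd (x, y) \<noteq> g (fst (x, y))"
    by (intro iterated_AE[of "\<lambda>z. fst z \<noteq> c \<and> snd z \<noteq> g (fst z)"])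
  then show ?thesis by simp
qed

lemma threshold_ruleE:
  assumes thr: "threshold_rule d m r"
  shows "\<exists>xbar\<in>X. \<exists>ybar \<in> X \<rightarrow> Y.
    (AE y in FY. AE x in K y. x \<noteq> xbar \<and> y \<noteq> ybar x \<longrightarrow>
       d x y \<in> {0, 1} \<and> (d x y = 1 \<longleftrightarrow> (x - xbar) * (y - ybar x) \<ge> 0)) \<and>
    (tie_free M sig prof \<longrightarrow>
      (AE y in FY. AE x in K y.
         d x y \<in> {0, 1} \<and> (d x y = 1 \<longleftrightarrow> (x - xbar) * (y - ybar x) \<ge> 0))) \<and>
    xbar = m \<and>
    (\<forall>x\<in>X. x \<noteq> m \<longrightarrow>
       ybar x = max ymin (min ymax (r * (p' m * (m - x) / (p m - p x)))))"
proof -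
  have mX: "m \<in> X"
    and AE: "AE y in FY. AE x in K y. x \<noteq> m \<and> y \<noteq> ybar m r x \<longrightarrow>
      d x y \<in> {0, 1} \<and> (d x y = 1 \<longleftrightarrow> (x - m) * (y - ybar m r x) \<ge> 0)"
    using thr by (simp_all add: threshold_rule_def)
  have AE_tf: "AE y in FY. AE x in K y.
      d x y \<in> {0, 1} \<and> (d x y = 1 \<longleftrightarrow> (x - m) * (y - ybar m r x) \<ge> 0)"
    if "tie_free M sig prof"
    using AE tie_free_AE[OF that ybar_measurable[OF mX], of m r]
  proof eventually_elim
    case (elim y)
    then show ?case by eventually_elim blast
  qed
  \<comment> \<open>A probability space is nonempty, hence so is \<open>Y\<close>; without this the
    truncation would not land in \<open>Y\<close>.\<close>
  have "ymin \<le> ymax" using law.not_empty unfolding space_law by (auto simp: Y_eq)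
  then have "ybar m r \<in> X \<rightarrow> Y" by (auto simp: ybar_def Y_eq)
  moreover have "\<forall>x\<in>X. x \<noteq> m \<longrightarrow>
      ybar m r x = max ymin (min ymax (r * (p' m * (m - x) / (p m - p x))))"
    by (simp add: ybar_def)
  ultimately show ?thesis using AE AE_tf
    by (intro bexI[OF _ mX] bexI[of _ "ybar m r"] conjI impI refl)
qed

end

text \<open>The pair \<open>(x1, y1)\<close> precedes the quantifier over rules and fixes the
  convention for zero non-disclosure mass, where the averages are undefined. The equivalence can
  fail at ties, which are null under \<open>tie_free\<close>. The formula is truncated so that the
  threshold takes values in \<open>Y\<close>.\<close>

theorem theorem1:
  fixes M :: "'a measure"
    and val sig prof :: "'a \<Rightarrow> real"
    and xmin xmax ymin ymax :: real
    and X Y :: "real set"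
    and FY :: "real measure"
    and K :: "real \<Rightarrow> real measure"
    and p p' :: "real \<Rightarrow> real"
  assumes "disclosure_model M val sig prof xmin xmax ymin ymax X Y FY K p p'"
  shows "(\<forall>x0\<in>X. \<exists>d. optimal_rule X Y FY K p x0 d) \<and>
    (\<exists>x1\<in>X. \<exists>y1\<in>Y. \<forall>x0\<in>X. \<forall>y0\<in>Y. \<forall>d.
       optimal_rule X Y FY K p x0 d \<and>
       (nd_mass X Y FY K d = 0 \<longrightarrow> x0 = x1 \<and> y0 = y1) \<longrightarrow>
       (\<exists>xbar\<in>X. \<exists>ybar \<in> X \<rightarrow> Y.
          (AE y in FY. AE x in K y. x \<noteq> xbar \<and> y \<noteq> ybar x \<longrightarrow>
             d x y \<in> {0, 1} \<and> (d x y = 1 \<longleftrightarrow> (x - xbar) * (y - ybar x) \<ge> 0)) \<and>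
          (tie_free M sig prof \<longrightarrow>
            (AE y in FY. AE x in K y.
               d x y \<in> {0, 1} \<and> (d x y = 1 \<longleftrightarrow> (x - xbar) * (y - ybar x) \<ge> 0))) \<and>
          xbar = x_nd X Y FY K x0 d \<and>
          (\<forall>x\<in>X. x \<noteq> x_nd X Y FY K x0 d \<longrightarrow>
             ybar x = max ymin (min ymax
               (y_nd X Y FY K y0 d *
                 (p' (x_nd X Y FY K x0 d) * (x_nd X Y FY K x0 d - x) /
                  (p (x_nd X Y FY K x0 d) - p x)))))))"
proof -
  interpret disclosure_model M val sig prof xmin xmax ymin ymax X Y FY K p p' by fact
  show ?thesis
  proof (rule optimal_rule_threshold)
    fix x1 y1
    assume x1: "x1 \<in> X" and y1: "y1 \<in> Y" and
      thr: "\<And>x0 y0 d. x0 \<in> X \<Longrightarrow> optimal_rule X Y FY K p x0 d \<Longrightarrow>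
        nd_mass X Y FY K d = 0 \<longrightarrow> x0 = x1 \<and> y0 = y1 \<Longrightarrow>
        threshold_rule d (x_nd X Y FY K x0 d) (y_nd X Y FY K y0 d)"
    show ?thesis
    proof (rule conjI)
      show "\<forall>x0\<in>X. \<exists>d. optimal_rule X Y FY K p x0 d" using optimal_rule_exists by blast
    qed (rule bexI[OF _ x1], rule bexI[OF _ y1], intro ballI allI impI, elim conjE,
        rule threshold_ruleE[OF thr])
  qed
qed

end
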